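(* Let $u_0,\eta_0\in C^1_b(\mathbb{R}^+)$ and $h\in C^2_b(\mathbb{R}^+)$ satisfy $$h(x)\ge 0,\qquad h'(x)\le 0,\qquad x\in\mathbb{R}^+,$$ and, for a fixed constant $C>0$, $$\eta_0(x)\ge C,\qquad u_0(x)\le -2\sqrt{h(x)+\eta_0(x)},\qquad x\in\mathbb{R}^+.$$ Set $\varphi_\pm:=u_0\pm 2\sqrt{h+\eta_0}$, $C_\varphi:=\max\{\|\varphi_+\|_{C^1_b},\|\varphi_-\|_{C^1_b}\}$ and $C_h:=\|h\|_{C^2_b}$. Then, for every $T>0$ satisfying $$T\le \min\left(\frac{C_\varphi}{C_h},\frac{1}{15\,C_\varphi}\right),$$ there exists a unique classical solution $u,\eta\in C^{1,1}(\Omega_T)$ of the shallow-water system $$\partial_t\eta+\partial_x\left[u(h(x)+\eta)\right]=0,\qquad \partial_t u+u\,\partial_x u+\partial_x\eta=0$$ in $\Omega_T$ such that $u|_{t=0}=u_0$ and $\eta|_{t=0}=\eta_0$. (No boundary condition is imposed at $x=0$.)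
   Context: $\mathbb{R}^+=[0,\infty)$. $C^n_b(\mathbb{R}^+)$ is the space of functions on $\mathbb{R}^+$ with bounded and continuous derivatives up to order $n$, with norm $\|f\|_{C^n_b}:=\sup_{x\in\mathbb{R}^+}|f(x)|+\sum_{j=1}^n\sup_{x\in\mathbb{R}^+}|f^{(j)}(x)|$. For $T>0$, $\Omega_T:=\{(t,x): t\in(0,T),\ x\in\mathbb{R}^+\}$, and $C^{1,1}(\Omega_T)$ is the space of bounded functions on $\Omega_T$ that are continuously differentiable in $t$ and $x$ with bounded first derivatives (derivatives in $x$ at $x=0$ are one-sided). Initial conditions are understood for the continuous extension to $t=0$. The gravitational constant is normalized to $g=1$. If $C_h=0$, the quotient $C_\varphi/C_h$ is read as $+\infty$. *)

theory Defs
  imports "HOL-Analysis.Analysis"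
begin

(* Functions on [0,\<infinity>) are total functions real \<Rightarrow> real whose values on the negative
   half-line are irrelevant; derivatives are therefore taken within {0..}, i.e. one-sided at 0. *)
definition hderiv :: "(real \<Rightarrow> real) \<Rightarrow> real \<Rightarrow> real" where
  "hderiv f x = vector_derivative f (at x within {0..})"

lemma hderiv_eqI:
  assumes "(f has_real_derivative D) (at x within {0..})" "0 \<le> x"
  shows "hderiv f x = D"
proof -
  have "{0..} \<noteq> {y}" for y :: real
  proof
    assume "{0..} = {y}"
    moreover have "0 \<in> {0::real..}" "1 \<in> {0::real..}" by auto
    ultimately show False by auto
  qed
  then have "x islimpt {0..}" using assms(2) by (intro connected_imp_perfect) auto
  then have "at x within {0..} \<noteq> bot" by (simp add: trivial_limit_within)
  then show ?thesis
    using assms(1) unfolding hderiv_def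
    by (intro vector_derivative_within) (simp_all add: has_real_derivative_iff_has_vector_derivative)
qed

definition Cb :: "nat \<Rightarrow> (real \<Rightarrow> real) set" where
  "Cb n = {f. (\<forall>j<n. \<forall>x\<ge>0. (hderiv ^^ j) f differentiable (at x within {0..})) \<and>
              (\<forall>j\<le>n. continuous_on {0..} ((hderiv ^^ j) f) \<and> bounded ((hderiv ^^ j) f ` {0..}))}"

(* The supremum is taken in the reals, so this is meaningful only for f \<in> Cb n. *)
definition Cb_norm :: "nat \<Rightarrow> (real \<Rightarrow> real) \<Rightarrow> real" where
  "Cb_norm n f = (SUP x\<in>{0..}. \<bar>f x\<bar>) + (\<Sum>j=1..n. SUP x\<in>{0..}. \<bar>(hderiv ^^ j) f x\<bar>)"

definition Omega :: "real \<Rightarrow> (real \<times> real) set" where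
  "Omega T = {0<..<T} \<times> {0..}"

(* Functions of (t,x) are curried, with time as the first argument. *)
definition dt :: "(real \<Rightarrow> real \<Rightarrow> real) \<Rightarrow> real \<Rightarrow> real \<Rightarrow> real" where
  "dt v t x = deriv (\<lambda>s. v s x) t"

definition dx :: "(real \<Rightarrow> real \<Rightarrow> real) \<Rightarrow> real \<Rightarrow> real \<Rightarrow> real" where
  "dx v t x = hderiv (v t) x"

(* Continuity of the partial derivatives is joint in (t,x); in particular v is C^1 on Omega T. *)
definition C11 :: "real \<Rightarrow> (real \<Rightarrow> real \<Rightarrow> real) set" where
  "C11 T = {v. bounded ((\<lambda>(t, x). v t x) ` Omega T) \<and>
     (\<forall>(t, x)\<in>Omega T. (\<lambda>s. v s x) field_differentiable (at t) \<and>
                       v t differentiable (at x within {0..})) \<and>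
     continuous_on (Omega T) (\<lambda>(t, x). dt v t x) \<and> bounded ((\<lambda>(t, x). dt v t x) ` Omega T) \<and>
     continuous_on (Omega T) (\<lambda>(t, x). dx v t x) \<and> bounded ((\<lambda>(t, x). dx v t x) ` Omega T)}"

(* v extends continuously from Omega T to t = 0, with boundary values v0. *)
definition initial_value :: "real \<Rightarrow> (real \<Rightarrow> real \<Rightarrow> real) \<Rightarrow> (real \<Rightarrow> real) \<Rightarrow> bool" where
  "initial_value T v v0 \<longleftrightarrow>
     (\<forall>x\<ge>0. ((\<lambda>(t, y). v t y) \<longlongrightarrow> v0 x) (at (0, x) within Omega T))"

definition shallow_water_solution ::
  "(real \<Rightarrow> real) \<Rightarrow> (real \<Rightarrow> real) \<Rightarrow> (real \<Rightarrow> real) \<Rightarrow> real \<Rightarrow>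
   (real \<Rightarrow> real \<Rightarrow> real) \<Rightarrow> (real \<Rightarrow> real \<Rightarrow> real) \<Rightarrow> bool" where
  "shallow_water_solution h u0 \<eta>0 T u \<eta> \<longleftrightarrow>
     u \<in> C11 T \<and> \<eta> \<in> C11 T \<and>
     (\<forall>(t, x)\<in>Omega T.
        dt \<eta> t x + dx (\<lambda>s y. u s y * (h y + \<eta> s y)) t x = 0 \<and>
        dt u t x + u t x * dx u t x + dx \<eta> t x = 0) \<and>
     initial_value T u u0 \<and> initial_value T \<eta> \<eta>0"

end

theory Submission
  imports Defs
begin

text \<open>With \<open>c = sqrt (h + \<eta>)\<close> the Riemann invariants \<open>r = u + 2c\<close> and \<open>s = u - 2c\<close> satisfy
  \<open>r\<^sub>t + (3r + s)/4 r\<^sub>x = h'\<close> and \<open>s\<^sub>t + (3s + r)/4 s\<^sub>x = h'\<close>. Since \<open>h' \<le> 0\<close>, the conditions \<open>r \<le> 0\<close>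
  and \<open>s \<le> 0\<close> propagate, so both speeds are nonpositive, nothing enters through \<open>x = 0\<close>, and the feet
  of the backward characteristics stay in the half-line.

  Existence: the explicit scheme \<open>r \<mapsto> r(x - d \<lambda>(x)) + d h'(x)\<close> with time step \<open>d\<close> and \<open>\<lambda> = (3r + s)/4\<close>
  preserves \<open>C\<^sup>1\<close>. The bound \<open>m\<close> on the first derivatives grows in one step to at most
  \<open>m + d(m\<^sup>2 + C\<^sub>h)\<close>, and the two smallness conditions on \<open>T\<close> keep it below \<open>5/2 C\<^sub>\<phi>\<close>. Moduli of continuity
  of the derivatives are propagated as well. Halving the time step changes one step by \<open>O(d\<^sup>2)\<close>, hence
  the dyadic approximations converge uniformly; equicontinuity turns this into convergence of the
  \<open>x\<close>-derivatives, and the one-step formula yields the \<open>t\<close>-derivative of the limit.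

  Uniqueness and the positivity of \<open>r - s\<close> come from a maximum principle for transport inequalities
  with nonpositive speeds.\<close>

section \<open>The semi-Lagrangian scheme\<close>

text \<open>The step follows a straight segment with the speed frozen at the arrival point, so no
  characteristic ODE is solved and each approximation is an explicit composition. Derivatives grow
  by a Riccati law with rate \<open>m\<^sup>2 + B\<close>. Replacing \<open>m\<close> by a ceiling
  \<open>M\<close> turns this into linear growth, and the smallness of \<open>T\<close> enters the
  construction only through the closing inequality \<open>A + T * (M\<^sup>2 + B) \<le> M\<close>.

  The obstacle is the loss of one derivative. Two approximations have different feet. Comparing
  their values there costs a Lipschitz constant, which the data provide; comparing their
  x-derivatives would cost a Lipschitz constant of the derivatives, which merely C^1 data do not
  provide. A rate of convergence is therefore proved in the sup norm only. A modulus of continuity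
  independent of the time step then makes the derivatives close to difference quotients over a fixed
  length, and these converge with the values.\<close>

lemma hderiv_works:
  assumes "f differentiable (at x within {0..})" "0 \<le> x"
  shows "(f has_real_derivative hderiv f x) (at x within {0..})"
proof -
  obtain D where "(f has_real_derivative D) (at x within {0..})"
    using assms(1) by (auto simp: real_differentiable_def)
  then show ?thesis using hderiv_eqI[OF _ assms(2)] by metis
qed

text \<open>Mean value inequality for \<open>f z - c * z\<close>. With \<open>c = f' x\<close> it is
  a Taylor estimate whose error is a modulus of continuity of the derivative, so derivative bounds
  that are uniform in the time step become uniform statements about values.\<close>

lemma taylor_bound:
  fixes f f' :: "real \<Rightarrow> real"
  assumes "\<And>z. 0 \<le> z \<Longrightarrow> (f has_real_derivative f' z) (at z within {0..})"
    and "\<And>z. z \<in> closed_segment x y \<Longrightarrow> \<bar>f' z - c\<bar> \<le> e" and "0 \<le> x" "0 \<le> y"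
  shows "\<bar>f y - f x - c * (y - x)\<bar> \<le> e * \<bar>y - x\<bar>"
proof -
  have sub: "closed_segment x y \<subseteq> {0..}"
    using assms(3,4) by (auto simp: closed_segment_eq_real_ivl)
  have "norm ((f y - c * y) - (f x - c * x)) \<le> e * norm (y - x)"
  proof (rule field_differentiable_bound[of "closed_segment x y" _ "\<lambda>z. f' z - c"])
    fix z assume "z \<in> closed_segment x y"
    with sub have "0 \<le> z" by auto
    then have "((\<lambda>x. f x - c * x) has_field_derivative f' z - c) (at z within {0..})"
      using assms(1) by (auto intro!: derivative_eq_intros)
    then show "((\<lambda>x. f x - c * x) has_field_derivative f' z - c) (at z within closed_segment x y)"
      using sub by (rule DERIV_subset)
  qed (use assms in auto)
  then show ?thesis by (simp add: algebra_simps)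
qed

lemma lipschitz_of_deriv_bound:
  fixes f f' :: "real \<Rightarrow> real"
  assumes "\<And>z. 0 \<le> z \<Longrightarrow> (f has_real_derivative f' z) (at z within {0..})"
    and "\<And>z. 0 \<le> z \<Longrightarrow> \<bar>f' z\<bar> \<le> K" and "0 \<le> x" "0 \<le> y"
  shows "\<bar>f x - f y\<bar> \<le> K * \<bar>x - y\<bar>"
proof -
  have "\<bar>f x - f y - 0 * (x - y)\<bar> \<le> K * \<bar>x - y\<bar>"
  proof (rule taylor_bound[OF assms(1)])
    fix z assume "z \<in> closed_segment y x"
    then have "0 \<le> z" using assms(3,4) by (auto simp: closed_segment_eq_real_ivl split: if_splits)
    then show "\<bar>f' z - 0\<bar> \<le> K" using assms(2) by simp
  qed (use assms in auto)
  then show ?thesis by simp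
qed

text \<open>One constant serves for the values and the derivative because both grow by at most the
  same amount in a step. The sign makes the speeds nonpositive and so keeps the feet of the
  characteristics in the half-line.\<close>

definition tame :: "real \<Rightarrow> (real \<Rightarrow> real) \<Rightarrow> bool" where
  "tame m a \<longleftrightarrow> (\<forall>x\<ge>0. a x \<le> 0 \<and> \<bar>a x\<bar> \<le> m \<and> \<bar>hderiv a x\<bar> \<le> m \<and> a differentiable (at x within {0..}))"

lemma tameD:
  assumes "tame m a" "0 \<le> x"
  shows "a x \<le> 0" "\<bar>a x\<bar> \<le> m" "\<bar>hderiv a x\<bar> \<le> m" "(a has_real_derivative hderiv a x) (at x within {0..})"
  using assms hderiv_works by (auto simp: tame_def)

lemma tame_mono: "tame m a \<Longrightarrow> m \<le> m' \<Longrightarrow> tame m' a"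
  unfolding tame_def by (meson order_trans)

lemma tame_lipschitz:
  assumes "tame m a" "0 \<le> x" "0 \<le> y"
  shows "\<bar>a x - a y\<bar> \<le> m * \<bar>x - y\<bar>"
  using lipschitz_of_deriv_bound[of a "hderiv a" m x y] tameD[OF assms(1)] assms(2,3) by blast

text \<open>The characteristic speeds of the Riemann invariants a and b are \<open>speed a b\<close> and \<open>speed b a\<close>.\<close>

definition speed :: "(real \<Rightarrow> real) \<Rightarrow> (real \<Rightarrow> real) \<Rightarrow> real \<Rightarrow> real" where
  "speed a b x = (3 * a x + b x) / 4"

text \<open>Explicit Euler step along a characteristic: the foot uses the speed at the point of
  arrival and at the old time, so only known values enter.\<close>

definition advance :: "(real \<Rightarrow> real) \<Rightarrow> real \<Rightarrow> (real \<Rightarrow> real) \<Rightarrow> (real \<Rightarrow> real) \<Rightarrow> real \<Rightarrow> real" where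
  "advance f d a b x = a (x - d * speed a b x) + d * f x"

text \<open>By the symmetry of the system under exchange of the invariants, one function serves
  both: \<open>scheme f d k a b\<close> is the invariant starting from \<open>a\<close>, and
  \<open>scheme f d k b a\<close> is its partner starting from \<open>b\<close>.\<close>

primrec scheme :: "(real \<Rightarrow> real) \<Rightarrow> real \<Rightarrow> nat \<Rightarrow> (real \<Rightarrow> real) \<Rightarrow> (real \<Rightarrow> real) \<Rightarrow> real \<Rightarrow> real" where
  "scheme f d 0 = (\<lambda>a b. a)"
| "scheme f d (Suc k) = (\<lambda>a b. advance f d (scheme f d k a b) (scheme f d k b a))"

text \<open>The speed is a convex combination of the invariants with weights 3/4 and 1/4, so it
  inherits their sign and their bounds with the same constant.\<close>

lemma tame_speed:
  assumes "tame m a" "tame m b" "0 \<le> x"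
  shows "speed a b x \<le> 0" "\<bar>speed a b x\<bar> \<le> m"
    "(speed a b has_real_derivative (3 * hderiv a x + hderiv b x) / 4) (at x within {0..})"
    "\<bar>(3 * hderiv a x + hderiv b x) / 4\<bar> \<le> m"
proof -
  note a = tameD[OF assms(1,3)] and b = tameD[OF assms(2,3)]
  show "speed a b x \<le> 0" using a(1) b(1) by (simp add: speed_def)
  show "\<bar>speed a b x\<bar> \<le> m" using a(2) b(2) by (simp add: speed_def abs_le_iff field_simps)
  show "\<bar>(3 * hderiv a x + hderiv b x) / 4\<bar> \<le> m" using a(3) b(3) by (simp add: abs_le_iff field_simps)
  show "(speed a b has_real_derivative (3 * hderiv a x + hderiv b x) / 4) (at x within {0..})"
    unfolding speed_def using a(4) b(4) by (auto intro!: derivative_eq_intros)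
qed

text \<open>\<open>f\<close> stands for the slope of \<open>h\<close>, the common source of both
  invariants, \<open>f'\<close> for the second derivative of \<open>h\<close>, and \<open>B\<close>
  for the norm \<open>Ch\<close>.\<close>

locale forcing =
  fixes f f' :: "real \<Rightarrow> real" and B :: real
  assumes f_deriv: "0 \<le> x \<Longrightarrow> (f has_real_derivative f' x) (at x within {0..})"
    and f'_cont: "continuous_on {0..} f'"
    and f_nonpos: "0 \<le> x \<Longrightarrow> f x \<le> 0"
    and f_bound: "0 \<le> x \<Longrightarrow> \<bar>f x\<bar> \<le> B"
    and f'_bound: "0 \<le> x \<Longrightarrow> \<bar>f' x\<bar> \<le> B"
begin

lemma B_nonneg: "0 \<le> B"
  using f_bound[of 0] by simp

lemma f_lipschitz: "0 \<le> x \<Longrightarrow> 0 \<le> y \<Longrightarrow> \<bar>f x - f y\<bar> \<le> B * \<bar>x - y\<bar>"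
  using lipschitz_of_deriv_bound[of f f' B x y] f_deriv f'_bound by blast

text \<open>Chain rule. The foot map sends the half-line into itself, which is what allows
  derivatives taken within \<open>{0..}\<close> to be composed, also at the boundary point.\<close>

lemma advance_deriv:
  assumes "tame m a" "tame m b" "0 \<le> d" "0 \<le> x"
  shows "(advance f d a b has_real_derivative
      hderiv a (x - d * speed a b x) * (1 - d * ((3 * hderiv a x + hderiv b x) / 4)) + d * f' x) (at x within {0..})"
proof -
  have pos: "0 \<le> y - d * speed a b y" if "0 \<le> y" for y
    using tame_speed(1)[OF assms(1,2) that] assms(3) that by (smt (verit) mult_nonneg_nonpos)
  have "(a has_real_derivative hderiv a (x - d * speed a b x)) (at (x - d * speed a b x) within (\<lambda>x. x - d * speed a b x) ` {0..})"
    using tameD(4)[OF assms(1) pos[OF assms(4)]] by (rule DERIV_subset) (auto intro: pos)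
  moreover have "((\<lambda>x. x - d * speed a b x) has_real_derivative 1 - d * ((3 * hderiv a x + hderiv b x) / 4)) (at x within {0..})"
    using tame_speed(3)[OF assms(1,2,4)] by (auto intro!: derivative_eq_intros)
  ultimately have "((\<lambda>x. a (x - d * speed a b x)) has_real_derivative
      hderiv a (x - d * speed a b x) * (1 - d * ((3 * hderiv a x + hderiv b x) / 4))) (at x within {0..})"
    using DERIV_image_chain by (force simp: o_def)
  then show ?thesis
    unfolding advance_def using f_deriv[OF assms(4)] by (auto intro!: derivative_eq_intros)
qed

lemma advance_foot:
  assumes "tame m a" "tame m b" "0 \<le> d" "0 \<le> x"
  shows "x \<le> x - d * speed a b x" "x - d * speed a b x \<le> x + d * m"
proof -
  have "d * (- speed a b x) \<le> d * m" "0 \<le> d * (- speed a b x)"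
    using tame_speed(1,2)[OF assms(1,2,4)] assms(3)
    by (intro mult_left_mono mult_nonneg_nonneg; linarith)+
  then show "x \<le> x - d * speed a b x" "x - d * speed a b x \<le> x + d * m" by auto
qed

lemma tame_nonneg: "tame m a \<Longrightarrow> 0 \<le> m"
  using tameD(2)[of m a 0] by simp

text \<open>The foot map has derivative \<open>1 - d * ?l\<close> with
  \<open>\<bar>?l\<bar> \<le> m\<close>, so the derivative of the new function gains at most
  \<open>d * m\<^sup>2\<close> from it and \<open>d * B\<close> from the source. Bounding
  \<open>m\<close> by the ceiling \<open>M\<close> makes the increment the same in every
  step.\<close>

lemma advance_tame:
  assumes a: "tame m a" and b: "tame m b" and d: "0 \<le> d" and m: "m \<le> M"
  shows "tame (m + d * (M\<^sup>2 + B)) (advance f d a b)"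
  unfolding tame_def
proof (intro allI impI conjI)
  fix x :: real assume x: "0 \<le> x"
  define y where "y = x - d * speed a b x"
  have y: "0 \<le> y" using advance_foot[OF a b d x] x by (simp add: y_def)
  have m0: "0 \<le> m" using tame_nonneg a .
  have "m\<^sup>2 \<le> M\<^sup>2" using m0 m by (intro power_mono)
  then have dm: "d * m\<^sup>2 \<le> d * M\<^sup>2" "0 \<le> d * M\<^sup>2" using d by (auto intro: mult_left_mono)
  have df: "d * f x \<le> 0" "\<bar>d * f x\<bar> \<le> d * B" "\<bar>d * f' x\<bar> \<le> d * B"
    using f_nonpos[OF x] f_bound[OF x] f'_bound[OF x] d
    by (auto simp: mult_nonneg_nonpos abs_mult simp del: abs_of_nonpos intro!: mult_left_mono)
  have adv: "advance f d a b x = a y + d * f x" by (simp add: advance_def y_def)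
  show "advance f d a b x \<le> 0" using adv tameD(1)[OF a y] df by simp
  show "\<bar>advance f d a b x\<bar> \<le> m + d * (M\<^sup>2 + B)"
    using adv tameD(2)[OF a y] df(2) dm by (simp add: algebra_simps)
  let ?l = "(3 * hderiv a x + hderiv b x) / 4"
  have D: "(advance f d a b has_real_derivative hderiv a y * (1 - d * ?l) + d * f' x) (at x within {0..})"
    using advance_deriv[OF a b d x] by (simp add: y_def)
  then show "advance f d a b differentiable (at x within {0..})"
    by (auto simp: real_differentiable_def)
  have "\<bar>hderiv a y * (d * ?l)\<bar> \<le> m * (d * m)"
    unfolding abs_mult using tameD(3)[OF a y] tame_speed(4)[OF a b x] d m0
    by (intro mult_mono) (auto intro: mult_left_mono)
  then have "\<bar>hderiv a y * (1 - d * ?l) + d * f' x\<bar> \<le> m + d * m\<^sup>2 + d * B"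
    using tameD(3)[OF a y] df(3) unfolding right_diff_distrib power2_eq_square mult_1_right mult.left_commute[of m d]
    by linarith
  also have "\<dots> \<le> m + d * (M\<^sup>2 + B)" using dm by (simp add: algebra_simps)
  finally show "\<bar>hderiv (advance f d a b) x\<bar> \<le> m + d * (M\<^sup>2 + B)"
    using hderiv_eqI[OF D x] by simp
qed

text \<open>Bootstrap: while the elapsed time is at most \<open>T\<close>, the last assumption keeps
  the accumulated bound below \<open>M\<close>, and this licenses one more step with increment
  \<open>d * (M\<^sup>2 + B)\<close>.\<close>

lemma scheme_tame:
  assumes "tame A a" "tame A b" "0 \<le> d" "real k * d \<le> T" "A + T * (M\<^sup>2 + B) \<le> M"
  shows "tame (A + real k * d * (M\<^sup>2 + B)) (scheme f d k a b)"
  using assms(1,2,4)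
proof (induction k arbitrary: a b)
  case (Suc k)
  have "real k * d \<le> real (Suc k) * d" using assms(3) by (simp add: algebra_simps)
  then have kd: "real k * d \<le> T" using Suc.prems by linarith
  have "0 \<le> M\<^sup>2 + B" using B_nonneg by simp
  then have le: "A + real k * d * (M\<^sup>2 + B) \<le> M"
    using mult_right_mono[OF kd] assms(5) by (smt (verit))
  have "tame (A + real k * d * (M\<^sup>2 + B) + d * (M\<^sup>2 + B)) (scheme f d (Suc k) a b)"
    using advance_tame[OF Suc.IH[OF Suc.prems(1,2) kd] Suc.IH[OF Suc.prems(2,1) kd] assms(3) le] by simp
  then show ?case by (simp add: algebra_simps)
qed simp

lemma scheme_tame_M:
  assumes "tame A a" "tame A b" "0 \<le> d" "real k * d \<le> T" "A + T * (M\<^sup>2 + B) \<le> M"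
  shows "tame M (scheme f d k a b)"
proof -
  have "0 \<le> M\<^sup>2 + B" using B_nonneg by simp
  then show ?thesis
    using mult_right_mono[OF assms(4)] assms(5) scheme_tame[OF assms] by (smt (verit) tame_mono)
qed

text \<open>The foot map has Lipschitz constant \<open>1 + d * M\<close> and moves points by at most
  \<open>d * M\<close>. Hence the old modulus is required at distances larger by that factor and on
  an interval longer by that amount, while the error grows by the factor
  \<open>1 + d * (2 * M + 1)\<close>.\<close>

lemma advance_equicont:
  assumes a: "tame M a" and b: "tame M b" and d: "0 \<le> d" "0 \<le> e"
    and mod: "\<And>c x y. c \<in> {a, b} \<Longrightarrow> x \<in> {0..R + d * M} \<Longrightarrow> y \<in> {0..R + d * M} \<Longrightarrow>
      \<bar>x - y\<bar> < \<epsilon> * (1 + d * M) \<Longrightarrow> \<bar>hderiv c x - hderiv c y\<bar> \<le> K * e"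
    and fmod: "\<And>x y. x \<in> {0..R} \<Longrightarrow> y \<in> {0..R} \<Longrightarrow> \<bar>x - y\<bar> < \<epsilon> \<Longrightarrow> \<bar>f' x - f' y\<bar> \<le> e"
    and K: "1 \<le> K" and x: "x \<in> {0..R}" and y: "y \<in> {0..R}" and xy: "\<bar>x - y\<bar> < \<epsilon>"
  shows "\<bar>hderiv (advance f d a b) x - hderiv (advance f d a b) y\<bar> \<le> K * (1 + d * (2 * M + 1)) * e"
proof -
  have M: "0 \<le> M" using tame_nonneg a .
  define X where "X = (\<lambda>x. x - d * speed a b x)"
  define l where "l = (\<lambda>x. (3 * hderiv a x + hderiv b x) / 4)"
  have x0: "0 \<le> x" "0 \<le> y" using x y by auto
  have D: "hderiv (advance f d a b) z = hderiv a (X z) * (1 - d * l z) + d * f' z" if "0 \<le> z" for z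
    using hderiv_eqI[OF advance_deriv[OF a b d(1) that] that] by (simp add: X_def l_def)
  have X: "X z \<in> {0..R + d * M}" if "z \<in> {0..R}" for z
    using advance_foot[OF a b d(1), of z] that by (auto simp: X_def)
  have dM: "0 \<le> d * M" using d M by simp
  have eps: "0 < \<epsilon>" using xy by linarith
  have "\<bar>x - y\<bar> \<le> \<bar>x - y\<bar> * (1 + d * M)" using mult_left_mono[of 1 "1 + d * M" "\<bar>x - y\<bar>"] dM by simp
  also have "\<dots> < \<epsilon> * (1 + d * M)" using xy dM by (intro mult_strict_right_mono) auto
  finally have xy': "\<bar>x - y\<bar> < \<epsilon> * (1 + d * M)" .
  have xR: "x \<in> {0..R + d * M}" "y \<in> {0..R + d * M}" using x y dM by auto
  have "\<bar>speed a b x - speed a b y\<bar> \<le> M * \<bar>x - y\<bar>"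
    using tame_lipschitz[OF a x0] tame_lipschitz[OF b x0] by (simp add: speed_def abs_le_iff field_simps)
  then have "d * \<bar>speed a b x - speed a b y\<bar> \<le> d * (M * \<bar>x - y\<bar>)" using d by (intro mult_left_mono)
  moreover have "\<bar>X x - X y\<bar> \<le> \<bar>x - y\<bar> + d * \<bar>speed a b x - speed a b y\<bar>"
  proof -
    have "X x - X y = (x - y) - d * (speed a b x - speed a b y)" by (simp add: X_def algebra_simps)
    then show ?thesis using abs_triangle_ineq4[of "x - y" "d * (speed a b x - speed a b y)"] d
      by (simp add: abs_mult)
  qed
  ultimately have "\<bar>X x - X y\<bar> \<le> \<bar>x - y\<bar> * (1 + d * M)" by (simp add: algebra_simps)
  also have "\<dots> < \<epsilon> * (1 + d * M)" using xy dM by (intro mult_strict_right_mono) auto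
  finally have 1: "\<bar>hderiv a (X x) - hderiv a (X y)\<bar> \<le> K * e"
    using mod[of a] X x y by auto
  have 2: "\<bar>l x - l y\<bar> \<le> K * e"
  proof -
    have "\<bar>hderiv a x - hderiv a y\<bar> \<le> K * e" "\<bar>hderiv b x - hderiv b y\<bar> \<le> K * e"
      using xR xy' by (auto intro!: mod)
    then show ?thesis by (simp add: l_def abs_le_iff field_simps)
  qed
  have 3: "\<bar>f' x - f' y\<bar> \<le> K * e" using fmod[OF x y xy] mult_right_mono[OF K d(2)] by simp
  \<comment> \<open>Discrete product rule: the derivative of \<open>a\<close> is compared at the two
    feet and the derivative of the foot map at the two points, each weighted by a bounded
    factor.\<close>
  have "hderiv (advance f d a b) x - hderiv (advance f d a b) y
      = (hderiv a (X x) - hderiv a (X y)) * (1 - d * l x) - d * (hderiv a (X y) * (l x - l y)) + d * (f' x - f' y)"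
    by (simp add: D x0 algebra_simps)
  moreover have "\<bar>(hderiv a (X x) - hderiv a (X y)) * (1 - d * l x)\<bar> \<le> K * e * (1 + d * M)"
  proof -
    have "d * \<bar>l x\<bar> \<le> d * M" unfolding l_def using tame_speed(4)[OF a b x0(1)] d(1) by (intro mult_left_mono)
    then have "\<bar>1 - d * l x\<bar> \<le> 1 + d * M" using d abs_triangle_ineq4[of 1 "d * l x"] by (simp add: abs_mult)
    then show ?thesis unfolding abs_mult using 1 K d by (intro mult_mono) auto
  qed
  moreover have "\<bar>d * (hderiv a (X y) * (l x - l y))\<bar> \<le> d * (M * (K * e))"
    unfolding abs_mult using 2 d M tameD(3)[OF a, of "X y"] X[OF y] by (intro mult_mono) auto
  moreover have "\<bar>d * (f' x - f' y)\<bar> \<le> d * (K * e)"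
    using 3 d by (auto simp: abs_mult intro: mult_left_mono)
  ultimately have "\<bar>hderiv (advance f d a b) x - hderiv (advance f d a b) y\<bar> \<le>
      K * e * (1 + d * M) + d * (M * (K * e)) + d * (K * e)" by linarith
  also have "\<dots> = K * (1 + d * (2 * M + 1)) * e" by (simp add: algebra_simps)
  finally show ?thesis .
qed

end

section \<open>Bounded growth factors and geometric convergence\<close>

lemma one_plus_power_le_exp:
  assumes "0 \<le> (z::real)" "real k * z \<le> c"
  shows "(1 + z) ^ k \<le> exp c"
proof -
  have "(1 + z) ^ k \<le> exp z ^ k"
    using assms by (intro power_mono exp_ge_add_one_self) auto
  also have "\<dots> = exp (real k * z)" by (simp add: exp_of_nat_mult)
  also have "\<dots> \<le> exp c" using assms by simp
  finally show ?thesis .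
qed

lemma geometric_limit:
  fixes X :: "nat \<Rightarrow> real"
  assumes "\<And>n. \<bar>X (Suc n) - X n\<bar> \<le> C / 2 ^ n"
  shows "\<bar>lim X - X n\<bar> \<le> 2 * C / 2 ^ n" "X \<longlonglongrightarrow> lim X"
proof -
  have C: "0 \<le> C" using assms[of 0] by simp
  have tail: "\<bar>X (n + j) - X n\<bar> \<le> 2 * C / 2 ^ n" for n j
  proof -
    \<comment> \<open>Subtracting the part of the geometric tail that is not yet used makes the
      induction close.\<close>
    have "\<bar>X (n + j) - X n\<bar> \<le> 2 * C / 2 ^ n - 2 * C / 2 ^ (n + j)"
    proof (induction j)
      case (Suc j)
      have "2 * C / 2 ^ (n + Suc j) + C / 2 ^ (n + j) = 2 * C / 2 ^ (n + j)"
        by (simp add: field_simps)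
      then show ?case using Suc assms[of "n + j"] unfolding add_Suc_right by linarith
    qed simp
    moreover have "0 \<le> 2 * C / 2 ^ (n + j)" using C by simp
    ultimately show ?thesis by linarith
  qed
  have "Cauchy X"
  proof (rule metric_CauchyI)
    fix e :: real assume e: "0 < e"
    have "(\<lambda>n. 2 * C * (1 / 2) ^ n) \<longlonglongrightarrow> 0"
      by (rule tendsto_mult_right_zero, rule LIMSEQ_power_zero) simp
    then have "eventually (\<lambda>n. 2 * C * (1 / 2) ^ n < e / 2) sequentially"
      using e by (intro order_tendstoD(2)[of _ 0]) auto
    then obtain N where N: "2 * C * (1 / 2) ^ N < e / 2"
      by (auto simp: eventually_sequentially)
    have near: "dist (X m) (X N) < e / 2" if "m \<ge> N" for m
    proof -
      have "\<bar>X m - X N\<bar> \<le> 2 * C / 2 ^ N" using tail[of N "m - N"] that by simp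
      also have "\<dots> = 2 * C * (1 / 2) ^ N" by (simp add: power_divide)
      finally show ?thesis using N by (simp add: dist_real_def)
    qed
    have "dist (X m) (X n) < e" if "m \<ge> N" "n \<ge> N" for m n
      using near[OF that(1)] near[OF that(2)] by (rule dist_triangle_half_l)
    then show "\<exists>M. \<forall>m\<ge>M. \<forall>n\<ge>M. dist (X m) (X n) < e" by blast
  qed
  then show lim: "X \<longlonglongrightarrow> lim X"
    by (simp add: Cauchy_convergent_iff convergent_LIMSEQ_iff)
  have "(\<lambda>j. X (n + j)) \<longlonglongrightarrow> lim X"
    using LIMSEQ_ignore_initial_segment[OF lim, of n] by (simp add: add.commute)
  then have "(\<lambda>j. \<bar>X (n + j) - X n\<bar>) \<longlonglongrightarrow> \<bar>lim X - X n\<bar>"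
    by (intro tendsto_rabs tendsto_diff tendsto_const)
  then show "\<bar>lim X - X n\<bar> \<le> 2 * C / 2 ^ n"
    by (rule tendsto_upperbound) (simp_all add: tail)
qed

section \<open>Iterating the step: moduli, stability, consistency\<close>

context forcing
begin

text \<open>Finite speed of propagation as a budget: from \<open>R + T * M\<close> at time zero, the
  interval loses \<open>d * M\<close> per step and still contains \<open>{0..R}\<close> while the
  elapsed time is at most \<open>T\<close>. The admissible distance shrinks by
  \<open>1 + d * M\<close> per step.\<close>

lemma scheme_equicont:
  assumes tame: "tame A a" "tame A b" and d: "0 \<le> d" "real k * d \<le> T"
    and M: "A + T * (M\<^sup>2 + B) \<le> M" and e: "0 \<le> e"
    and mod: "\<And>c x y. c \<in> {hderiv a, hderiv b, f'} \<Longrightarrow> x \<in> {0..R + T * M} \<Longrightarrow> y \<in> {0..R + T * M} \<Longrightarrow>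
      \<bar>x - y\<bar> < \<epsilon> \<Longrightarrow> \<bar>c x - c y\<bar> \<le> e"
    and x: "x \<in> {0..R + (T - real k * d) * M}" and y: "y \<in> {0..R + (T - real k * d) * M}"
    and xy: "\<bar>x - y\<bar> < \<epsilon> / (1 + d * M) ^ k"
  shows "\<bar>hderiv (scheme f d k a b) x - hderiv (scheme f d k a b) y\<bar> \<le> (1 + d * (2 * M + 1)) ^ k * e"
  using tame d(2) mod x y xy
proof (induction k arbitrary: a b x y)
  case 0
  then show ?case by simp
next
  case (Suc k)
  have "real k * d \<le> real (Suc k) * d" using d(1) by (simp add: algebra_simps)
  then have kd: "real k * d \<le> T" using Suc.prems by linarith
  note t = scheme_tame_M[OF Suc.prems(1,2) d(1) kd M] and t' = scheme_tame_M[OF Suc.prems(2,1) d(1) kd M]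
  have M0: "0 \<le> M" using tame_nonneg[OF t] .
  let ?R = "R + (T - real (Suc k) * d) * M" and ?\<epsilon> = "\<epsilon> / (1 + d * M) ^ Suc k"
  have pos: "0 < 1 + d * M" using d(1) M0 by (simp add: add_pos_nonneg)
  have R: "?R + d * M = R + (T - real k * d) * M" by (simp add: algebra_simps)
  have \<epsilon>: "?\<epsilon> * (1 + d * M) = \<epsilon> / (1 + d * M) ^ k" using pos by simp
  have "0 < ?\<epsilon>" using Suc.prems(7) by linarith
  then have \<epsilon>0: "0 < \<epsilon>" using divide_nonpos_pos[OF _ zero_less_power[OF pos, of "Suc k"], of \<epsilon>] by linarith
  have "?\<epsilon> \<le> \<epsilon>" using \<epsilon>0 d(1) M0 by (simp add: divide_le_eq mult_le_cancel_left1 one_le_power del: power_Suc)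
  moreover have "?R \<le> R + T * M" using d(1) M0 by (simp add: mult_right_mono)
  ultimately have fmod: "\<bar>f' x - f' y\<bar> \<le> e" if "x \<in> {0..?R}" "y \<in> {0..?R}" "\<bar>x - y\<bar> < ?\<epsilon>" for x y
    using that by (intro Suc.prems(4)) auto
  have K: "1 \<le> (1 + d * (2 * M + 1)) ^ k" using d(1) M0 by (intro one_le_power) simp
  have mod': "\<bar>c x - c y\<bar> \<le> e" if "c \<in> {hderiv b, hderiv a, f'}" "x \<in> {0..R + T * M}" "y \<in> {0..R + T * M}"
      "\<bar>x - y\<bar> < \<epsilon>" for c x y
    using that Suc.prems(4)[of c x y] by (simp add: insert_commute)
  have mod: "\<bar>hderiv c x - hderiv c y\<bar> \<le> (1 + d * (2 * M + 1)) ^ k * e"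
    if "c \<in> {scheme f d k a b, scheme f d k b a}" "x \<in> {0..?R + d * M}" "y \<in> {0..?R + d * M}"
      "\<bar>x - y\<bar> < ?\<epsilon> * (1 + d * M)" for c x y
  proof -
    note xy = that(2-4)[unfolded R \<epsilon>]
    have "\<bar>hderiv (scheme f d k a b) x - hderiv (scheme f d k a b) y\<bar> \<le> (1 + d * (2 * M + 1)) ^ k * e"
      by (rule Suc.IH[OF Suc.prems(1,2) kd _ xy]) (erule Suc.prems(4))
    moreover have "\<bar>hderiv (scheme f d k b a) x - hderiv (scheme f d k b a) y\<bar> \<le> (1 + d * (2 * M + 1)) ^ k * e"
      by (rule Suc.IH[OF Suc.prems(2,1) kd _ xy]) (erule mod')
    ultimately show ?thesis using that(1) by auto
  qed
  have "\<bar>hderiv (advance f d (scheme f d k a b) (scheme f d k b a)) x - hderiv (advance f d (scheme f d k a b) (scheme f d k b a)) y\<bar>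
      \<le> (1 + d * (2 * M + 1)) ^ k * (1 + d * (2 * M + 1)) * e"
    by (rule advance_equicont[OF t t' d(1) e mod fmod K Suc.prems(5,6,7)])
  then show ?case by (simp add: mult.commute)
qed

text \<open>The foot is displaced by at most \<open>d * M\<close> and \<open>a\<close> has Lipschitz
  constant \<open>M\<close>. This serves both the comparison of a step with two half steps and the
  Lipschitz bound in time.\<close>

lemma advance_diff:
  assumes "tame M a" "tame M b" "0 \<le> d" "0 \<le> x"
  shows "\<bar>advance f d a b x - a x\<bar> \<le> d * (M\<^sup>2 + B)"
proof -
  have M0: "0 \<le> M" using tame_nonneg[OF assms(1)] .
  note X = advance_foot[OF assms]
  have "\<bar>a (x - d * speed a b x) - a x\<bar> \<le> M * \<bar>(x - d * speed a b x) - x\<bar>"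
    using X assms(4) by (intro tame_lipschitz[OF assms(1)]) auto
  also have "\<dots> \<le> M * (d * M)" using X M0 by (intro mult_left_mono) auto
  finally have "\<bar>a (x - d * speed a b x) - a x\<bar> \<le> d * M\<^sup>2" by (simp add: power2_eq_square mult_ac)
  moreover have "\<bar>d * f x\<bar> \<le> d * B"
    using f_bound[OF assms(4)] assms(3) by (auto simp: abs_mult intro: mult_left_mono)
  ultimately show ?thesis unfolding advance_def by (simp add: algebra_simps)
qed

text \<open>The two feet differ by at most \<open>d * D\<close>, and the Lipschitz constant of
  \<open>a'\<close> absorbs this. Only sup norms of the differences occur, so no derivatives are
  compared.\<close>

lemma advance_stable:
  assumes t: "tame M a" "tame M b" "tame M a'" "tame M b'" and d: "0 \<le> d" and x: "0 \<le> x"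
    and D: "\<And>y. 0 \<le> y \<Longrightarrow> \<bar>a y - a' y\<bar> \<le> D" "\<And>y. 0 \<le> y \<Longrightarrow> \<bar>b y - b' y\<bar> \<le> D"
  shows "\<bar>advance f d a b x - advance f d a' b' x\<bar> \<le> (1 + d * M) * D"
proof -
  have M0: "0 \<le> M" using tame_nonneg[OF t(1)] .
  let ?X = "x - d * speed a b x" and ?X' = "x - d * speed a' b' x"
  have X: "0 \<le> ?X" "0 \<le> ?X'" using advance_foot(1)[OF t(1,2) d x] advance_foot(1)[OF t(3,4) d x] x by auto
  have "\<bar>speed a b x - speed a' b' x\<bar> \<le> D"
    using D[OF x] by (simp add: speed_def abs_le_iff field_simps)
  then have "d * \<bar>speed a b x - speed a' b' x\<bar> \<le> d * D" using d by (intro mult_left_mono)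
  moreover have "\<bar>?X - ?X'\<bar> = d * \<bar>speed a b x - speed a' b' x\<bar>"
  proof -
    have "?X - ?X' = d * (speed a' b' x - speed a b x)" by (simp add: algebra_simps)
    then show ?thesis using d by (simp add: abs_mult abs_minus_commute)
  qed
  ultimately have "M * \<bar>?X - ?X'\<bar> \<le> M * (d * D)" using M0 by (intro mult_left_mono) auto
  then have "\<bar>a' ?X - a' ?X'\<bar> \<le> M * (d * D)" using tame_lipschitz[OF t(3) X] by linarith
  moreover have "\<bar>a ?X - a' ?X\<bar> \<le> D" using D X by simp
  ultimately show ?thesis unfolding advance_def by (simp add: algebra_simps)
qed

text \<open>The speeds met by two short steps differ from the initial one by \<open>O(d)\<close>,
  through the change of time level and of position. The feet thus differ by
  \<open>O(d\<^sup>2)\<close>, and so do the sources \<open>2 * d * f x\<close> and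
  \<open>d * f x + d * f y\<close>. Lipschitz bounds suffice for this.\<close>

lemma advance_halve:
  assumes t: "tame M a" "tame M b" and t1: "tame M (advance f d a b)" "tame M (advance f d b a)"
    and d: "0 \<le> d" and x: "0 \<le> x"
  shows "\<bar>advance f (2 * d) a b x - advance f d (advance f d a b) (advance f d b a) x\<bar> \<le> 2 * M * (M\<^sup>2 + B) * d\<^sup>2"
proof -
  have M0: "0 \<le> M" using tame_nonneg[OF t(1)] .
  define v where "v = speed a b"
  define v1 where "v1 = speed (advance f d a b) (advance f d b a)"
  define y where "y = x - d * v1 x"
  \<comment> \<open>\<open>z\<close> is the foot of one step of length \<open>2 * d\<close>.
    \<open>z'\<close> is reached by two steps of length \<open>d\<close>: backwards to
    \<open>y\<close> with the speed \<open>v1\<close> of the later time level, then from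
    \<open>y\<close> with \<open>v\<close>.\<close>
  define z where "z = x - 2 * d * v x"
  define z' where "z' = y - d * v y"
  have y: "x \<le> y" "y \<le> x + d * M" using advance_foot[OF t1 d x] by (auto simp: y_def v1_def)
  have z: "0 \<le> z" using advance_foot(1)[OF t, of "2 * d" x] d x by (simp add: z_def v_def)
  have z': "0 \<le> z'" using advance_foot(1)[OF t, of d y] d x y by (simp add: z'_def v_def)
  have "\<bar>v1 x - v x\<bar> \<le> d * (M\<^sup>2 + B)"
    using advance_diff[OF t d x] advance_diff[OF t(2,1) d x]
    by (simp add: v1_def v_def speed_def abs_le_iff field_simps)
  moreover have "\<bar>v y - v x\<bar> \<le> M * (d * M)"
  proof -
    have "0 \<le> y" using x y by simp
    then have "\<bar>v y - v x\<bar> \<le> M * \<bar>y - x\<bar>"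
      using tame_lipschitz[OF t(1) \<open>0 \<le> y\<close> x] tame_lipschitz[OF t(2) \<open>0 \<le> y\<close> x]
      by (simp add: v_def speed_def abs_le_iff field_simps)
    also have "\<dots> \<le> M * (d * M)" using y M0 by (intro mult_left_mono) auto
    finally show ?thesis .
  qed
  ultimately have "\<bar>(v1 x - v x) + (v y - v x)\<bar> \<le> d * (M\<^sup>2 + B) + M * (d * M)" by linarith
  then have "d * \<bar>(v1 x - v x) + (v y - v x)\<bar> \<le> d * (d * (M\<^sup>2 + B) + M * (d * M))"
    using d by (intro mult_left_mono)
  moreover have "\<bar>z - z'\<bar> = d * \<bar>(v1 x - v x) + (v y - v x)\<bar>"
  proof -
    have "z - z' = d * ((v1 x - v x) + (v y - v x))" by (simp add: z_def z'_def y_def algebra_simps)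
    then show ?thesis using d by (simp add: abs_mult)
  qed
  ultimately have "M * \<bar>z - z'\<bar> \<le> M * (d * (d * (M\<^sup>2 + B) + M * (d * M)))" using M0 by (intro mult_left_mono) auto
  then have 1: "\<bar>a z - a z'\<bar> \<le> M * (d * (d * (M\<^sup>2 + B) + M * (d * M)))" using tame_lipschitz[OF t(1) z z'] by linarith
  have "\<bar>f x - f y\<bar> \<le> B * \<bar>x - y\<bar>" using x y by (intro f_lipschitz) auto
  also have "\<dots> \<le> B * (d * M)" using y B_nonneg by (intro mult_left_mono) auto
  finally have "\<bar>d * (f x - f y)\<bar> \<le> d * (B * (d * M))" using d by (auto simp: abs_mult intro: mult_left_mono)
  moreover have "advance f (2 * d) a b x - advance f d (advance f d a b) (advance f d b a) x
      = (a z - a z') + d * (f x - f y)"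
    by (simp add: advance_def[of f "2 * d"] advance_def[of f d "advance f d a b"] v1_def[symmetric]
        y_def[symmetric]) (simp add: advance_def v_def[symmetric] z_def z'_def algebra_simps)
  ultimately have "\<bar>advance f (2 * d) a b x - advance f d (advance f d a b) (advance f d b a) x\<bar>
      \<le> M * (d * (d * (M\<^sup>2 + B) + M * (d * M))) + d * (B * (d * M))" using 1 by linarith
  also have "\<dots> = 2 * M * (M\<^sup>2 + B) * d\<^sup>2" by (simp add: algebra_simps power2_eq_square)
  finally show ?thesis .
qed

text \<open>Stability plus consistency: one coarse step applied to the fine iterates is the
  intermediate term. The old error is amplified by \<open>1 + 2 * d * M\<close> and a new error of
  order \<open>d\<^sup>2\<close> is added; \<open>k\<close> such errors amount to
  \<open>O(d)\<close> because \<open>k * d\<close> is bounded.\<close>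

lemma scheme_halve:
  assumes "tame A a" "tame A b" "0 \<le> d" "real k * (2 * d) \<le> T" "A + T * (M\<^sup>2 + B) \<le> M" "0 \<le> x"
  shows "\<bar>scheme f (2 * d) k a b x - scheme f d (2 * k) a b x\<bar>
      \<le> (1 + 2 * d * M) ^ k * (real k * (2 * M * (M\<^sup>2 + B) * d\<^sup>2))"
  using assms(1,2,4,6)
proof (induction k arbitrary: a b x)
  case (Suc k)
  note d = assms(3)
  let ?K = "2 * M * (M\<^sup>2 + B) * d\<^sup>2" and ?q = "1 + 2 * d * M"
  have "real (2 * k) * d \<le> T" and kd: "real k * (2 * d) \<le> T" and "real (Suc (2 * k)) * d \<le> T"
    using Suc.prems d by (auto simp: algebra_simps)
  then have tm: "tame M (scheme f (2 * d) k a b)" "tame M (scheme f (2 * d) k b a)"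
    "tame M (scheme f d (2 * k) a b)" "tame M (scheme f d (2 * k) b a)"
    "tame M (scheme f d (Suc (2 * k)) a b)" "tame M (scheme f d (Suc (2 * k)) b a)"
    using Suc.prems d assms(5) by (intro scheme_tame_M[of A _ _ _ _ T]; simp)+
  have M0: "0 \<le> M" using tame_nonneg[OF tm(1)] .
  have K: "0 \<le> ?K" using M0 B_nonneg by simp
  define D where "D = ?q ^ k * (real k * ?K)"
  have "\<bar>advance f (2 * d) (scheme f (2 * d) k a b) (scheme f (2 * d) k b a) x
      - advance f (2 * d) (scheme f d (2 * k) a b) (scheme f d (2 * k) b a) x\<bar> \<le> ?q * D"
    using Suc.IH[OF Suc.prems(1,2) kd] Suc.IH[OF Suc.prems(2,1) kd] d Suc.prems(4)
    by (intro advance_stable tm) (auto simp: D_def)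
  moreover have "\<bar>advance f (2 * d) (scheme f d (2 * k) a b) (scheme f d (2 * k) b a) x
     - advance f d (scheme f d (Suc (2 * k)) a b) (scheme f d (Suc (2 * k)) b a) x\<bar> \<le> ?K"
    using advance_halve[of M "scheme f d (2 * k) a b" "scheme f d (2 * k) b a" d x] tm d Suc.prems(4) by simp
  ultimately have "\<bar>scheme f (2 * d) (Suc k) a b x - scheme f d (2 * Suc k) a b x\<bar> \<le> ?q * D + ?K"
    by simp
  also have "?q * D = ?q ^ Suc k * (real k * ?K)" by (simp add: D_def)
  also have "\<dots> + ?K \<le> ?q ^ Suc k * (real k * ?K) + ?q ^ Suc k * ?K"
  proof -
    have "1 \<le> ?q ^ Suc k" using d M0 by (intro one_le_power) simp
    then show ?thesis using K mult_right_mono[of 1 "?q ^ Suc k" ?K] by simp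
  qed
  also have "\<dots> = ?q ^ Suc k * (real (Suc k) * ?K)" by (simp add: algebra_simps)
  finally show ?case .
qed simp

lemma scheme_diff:
  assumes "tame A a" "tame A b" "0 \<le> d" "real (k + j) * d \<le> T" "A + T * (M\<^sup>2 + B) \<le> M" "0 \<le> x"
  shows "\<bar>scheme f d (k + j) a b x - scheme f d k a b x\<bar> \<le> real j * d * (M\<^sup>2 + B)"
  using assms(4)
proof (induction j)
  case (Suc j)
  have "real (k + j) * d \<le> T" using Suc.prems assms(3) by (auto simp: algebra_simps)
  note t = scheme_tame_M[OF assms(1,2,3) this assms(5)] scheme_tame_M[OF assms(2,1,3) this assms(5)] Suc.IH[OF this]
  show ?case using advance_diff[OF t(1,2) assms(3,6)] t(3) by (simp add: algebra_simps)
qed simp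

end

section \<open>Convergence along dyadic time steps\<close>

text \<open>Piecewise constant in time. Dyadic steps make successive grids nested, so consecutive
  approximations can be compared by halving the step.\<close>

definition approx :: "(real \<Rightarrow> real) \<Rightarrow> real \<Rightarrow> nat \<Rightarrow> (real \<Rightarrow> real) \<Rightarrow> (real \<Rightarrow> real) \<Rightarrow> real \<Rightarrow> real \<Rightarrow> real" where
  "approx f T n a b t = scheme f (T / 2 ^ n) (nat \<lfloor>t / (T / 2 ^ n)\<rfloor>) a b"

definition sol :: "(real \<Rightarrow> real) \<Rightarrow> real \<Rightarrow> (real \<Rightarrow> real) \<Rightarrow> (real \<Rightarrow> real) \<Rightarrow> real \<Rightarrow> real \<Rightarrow> real" where
  "sol f T a b t x = lim (\<lambda>n. approx f T n a b t x)"

text \<open>The limit of the x-derivatives of the approximations, not the derivative of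
  \<open>sol\<close>; that the two agree is \<open>sol_deriv_x\<close>.\<close>

definition solx :: "(real \<Rightarrow> real) \<Rightarrow> real \<Rightarrow> (real \<Rightarrow> real) \<Rightarrow> (real \<Rightarrow> real) \<Rightarrow> real \<Rightarrow> real \<Rightarrow> real" where
  "solx f T a b t x = lim (\<lambda>n. hderiv (approx f T n a b t) x)"

lemma two_power_small:
  assumes "0 < (e::real)"
  shows "\<exists>N. \<forall>n\<ge>N. c / 2 ^ n < e"
proof -
  have "(\<lambda>n. c * (1 / 2) ^ n) \<longlonglongrightarrow> 0"
    by (rule tendsto_mult_right_zero, rule LIMSEQ_power_zero) simp
  then have "eventually (\<lambda>n. c * (1 / 2) ^ n < e) sequentially"
    using assms by (intro order_tendstoD(2)[of _ 0]) auto
  then show ?thesis by (simp add: eventually_sequentially power_divide)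
qed

lemma grid_index:
  assumes "0 < (d::real)" "0 \<le> t"
  shows "real (nat \<lfloor>t / d\<rfloor>) * d \<le> t" "t < (real (nat \<lfloor>t / d\<rfloor>) + 1) * d"
proof -
  have "real (nat \<lfloor>t / d\<rfloor>) = of_int \<lfloor>t / d\<rfloor>" using assms by simp
  then have "real (nat \<lfloor>t / d\<rfloor>) \<le> t / d" "t / d < real (nat \<lfloor>t / d\<rfloor>) + 1"
    by linarith+
  then show "real (nat \<lfloor>t / d\<rfloor>) * d \<le> t" "t < (real (nat \<lfloor>t / d\<rfloor>) + 1) * d"
    using assms(1) by (auto simp: field_simps)
qed

text \<open>\<open>A\<close> bounds the initial invariants, and \<open>M\<close> is the ceiling for
  the approximations up to time \<open>T\<close>.\<close>

locale riemann = forcing +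
  fixes A M T :: real and a b :: "real \<Rightarrow> real"
  assumes tame_a: "tame A a" and tame_b: "tame A b"
    and cont_a: "continuous_on {0..} (hderiv a)" and cont_b: "continuous_on {0..} (hderiv b)"
    and T_pos: "0 < T" and M: "A + T * (M\<^sup>2 + B) \<le> M"
begin

text \<open>Carries every result about \<open>sol f T a b\<close> over to the other invariant
  \<open>sol f T b a\<close>.\<close>

lemma swap: "riemann f f' B A M T b a"
  by unfold_locales (fact tame_a tame_b cont_a cont_b T_pos M)+

definition "step n = T / 2 ^ n"
definition "index n t = nat \<lfloor>t / step n\<rfloor>"

lemma step_pos: "0 < step n"
  using T_pos by (simp add: step_def)

lemma approx_eq: "approx f T n a b t = scheme f (step n) (index n t) a b"
  "approx f T n b a t = scheme f (step n) (index n t) b a"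
  by (simp_all add: approx_def step_def index_def)

lemma index:
  assumes "0 \<le> t"
  shows "real (index n t) * step n \<le> t" "t < (real (index n t) + 1) * step n"
  using grid_index[OF step_pos assms] by (simp_all add: index_def)

lemma index_grid: "index n (real k * step n) = k"
  using step_pos[of n] by (simp add: index_def)

lemma M_nonneg: "0 \<le> M"
proof -
  have "0 \<le> T * (M\<^sup>2 + B)" using T_pos B_nonneg by simp
  then show ?thesis using M tame_nonneg[OF tame_a] by simp
qed

lemma approx_tame:
  assumes "0 \<le> t" "t \<le> T"
  shows "tame M (approx f T n a b t)"
  unfolding approx_eq using index(1)[OF assms(1), of n] assms(2) step_pos[of n]
  by (intro scheme_tame_M[OF tame_a tame_b _ _ M]) auto

text \<open>The factors accumulated over at most \<open>T\<close> of elapsed time are bounded by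
  \<open>exp (T * (2 * M + 1))\<close> for the error and \<open>exp (T * M)\<close> for the
  distance. Dividing \<open>e\<close> and the modulus of the data by them in advance gives a modulus
  valid for all \<open>n\<close> and \<open>t\<close>.\<close>

lemma approx_equicont:
  assumes "0 \<le> R" "0 < e"
  shows "\<exists>\<epsilon>>0. \<forall>n t x y. 0 \<le> t \<longrightarrow> t \<le> T \<longrightarrow> x \<in> {0..R} \<longrightarrow> y \<in> {0..R} \<longrightarrow> \<bar>x - y\<bar> < \<epsilon> \<longrightarrow>
    \<bar>hderiv (approx f T n a b t) x - hderiv (approx f T n a b t) y\<bar> \<le> e"
proof -
  define e0 where "e0 = e / exp (T * (2 * M + 1))"
  have e0: "0 < e0" using assms by (simp add: e0_def)
  have uc: "\<exists>\<epsilon>>0. \<forall>x\<in>{0..R + T * M}. \<forall>y\<in>{0..R + T * M}. \<bar>x - y\<bar> < \<epsilon> \<longrightarrow> \<bar>c x - c y\<bar> \<le> e0"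
    if "continuous_on {0..} c" for c :: "real \<Rightarrow> real"
  proof -
    have "uniformly_continuous_on {0..R + T * M} c"
      by (rule compact_uniformly_continuous[OF continuous_on_subset[OF that]]) auto
    then obtain \<epsilon> where "\<epsilon> > 0" "\<And>x y. x \<in> {0..R + T * M} \<Longrightarrow> y \<in> {0..R + T * M} \<Longrightarrow> dist y x < \<epsilon> \<Longrightarrow> dist (c y) (c x) < e0"
      unfolding uniformly_continuous_on_def using e0 by metis
    then show ?thesis unfolding dist_real_def by (metis less_imp_le)
  qed
  obtain \<epsilon>1 where \<epsilon>1: "\<epsilon>1 > 0" "\<forall>x\<in>{0..R + T * M}. \<forall>y\<in>{0..R + T * M}. \<bar>x - y\<bar> < \<epsilon>1 \<longrightarrow> \<bar>hderiv a x - hderiv a y\<bar> \<le> e0"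
    using uc[OF cont_a] by blast
  obtain \<epsilon>2 where \<epsilon>2: "\<epsilon>2 > 0" "\<forall>x\<in>{0..R + T * M}. \<forall>y\<in>{0..R + T * M}. \<bar>x - y\<bar> < \<epsilon>2 \<longrightarrow> \<bar>hderiv b x - hderiv b y\<bar> \<le> e0"
    using uc[OF cont_b] by blast
  obtain \<epsilon>3 where \<epsilon>3: "\<epsilon>3 > 0" "\<forall>x\<in>{0..R + T * M}. \<forall>y\<in>{0..R + T * M}. \<bar>x - y\<bar> < \<epsilon>3 \<longrightarrow> \<bar>f' x - f' y\<bar> \<le> e0"
    using uc[OF f'_cont] by blast
  define \<epsilon>0 where "\<epsilon>0 = min \<epsilon>1 (min \<epsilon>2 \<epsilon>3)"
  have \<epsilon>0: "\<epsilon>0 > 0" using \<epsilon>1 \<epsilon>2 \<epsilon>3 by (simp add: \<epsilon>0_def)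
  have mod: "\<bar>c x - c y\<bar> \<le> e0" if "c \<in> {hderiv a, hderiv b, f'}" "x \<in> {0..R + T * M}" "y \<in> {0..R + T * M}"
      "\<bar>x - y\<bar> < \<epsilon>0" for c x y
    using that(1)
  proof (elim insertE emptyE)
    show "c = hderiv a \<Longrightarrow> ?thesis" using \<epsilon>1(2) that(2-4) unfolding \<epsilon>0_def by simp
    show "c = hderiv b \<Longrightarrow> ?thesis" using \<epsilon>2(2) that(2-4) unfolding \<epsilon>0_def by simp
    show "c = f' \<Longrightarrow> ?thesis" using \<epsilon>3(2) that(2-4) unfolding \<epsilon>0_def by simp
  qed
  define \<epsilon> where "\<epsilon> = \<epsilon>0 / exp (T * M)"
  have "\<epsilon> > 0" using \<epsilon>0 by (simp add: \<epsilon>_def)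
  moreover have "\<bar>hderiv (approx f T n a b t) x - hderiv (approx f T n a b t) y\<bar> \<le> e"
    if "0 \<le> t" "t \<le> T" "x \<in> {0..R}" "y \<in> {0..R}" "\<bar>x - y\<bar> < \<epsilon>" for n t x y
  proof -
    define k where "k = index n t"
    define d where "d = step n"
    have d: "0 \<le> d" "real k * d \<le> T" using index(1)[OF that(1), of n] that(2) step_pos[of n]
      by (auto simp: k_def d_def)
    have kM: "real k * (d * M) \<le> T * M" "real k * (d * (2 * M + 1)) \<le> T * (2 * M + 1)"
      using mult_right_mono[OF d(2), of M] mult_right_mono[OF d(2), of "2 * M + 1"] M_nonneg
      by (simp_all add: mult.assoc)
    have dM: "0 \<le> d * M" "0 \<le> d * (2 * M + 1)" using d M_nonneg by auto
    have pw: "(1 + d * M) ^ k \<le> exp (T * M)" "(1 + d * (2 * M + 1)) ^ k \<le> exp (T * (2 * M + 1))"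
      using one_plus_power_le_exp dM kM by blast+
    have "0 < (1 + d * M) ^ k" using dM by (intro zero_less_power) simp
    then have "\<epsilon> \<le> \<epsilon>0 / (1 + d * M) ^ k"
      unfolding \<epsilon>_def using pw \<epsilon>0 by (intro divide_left_mono) auto
    then have xy: "\<bar>x - y\<bar> < \<epsilon>0 / (1 + d * M) ^ k" using that by simp
    have "0 \<le> (T - real k * d) * M" using d M_nonneg by simp
    then have R: "x \<in> {0..R + (T - real k * d) * M}" "y \<in> {0..R + (T - real k * d) * M}"
      using that by auto
    have "\<bar>hderiv (scheme f d k a b) x - hderiv (scheme f d k a b) y\<bar> \<le> (1 + d * (2 * M + 1)) ^ k * e0"
      by (rule scheme_equicont[OF tame_a tame_b d M less_imp_le[OF e0] _ R xy]) (erule mod)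
    also have "\<dots> \<le> exp (T * (2 * M + 1)) * e0" using pw e0 by (intro mult_right_mono) auto
    also have "\<dots> = e" by (simp add: e0_def)
    finally show ?thesis by (simp add: approx_eq k_def d_def)
  qed
  ultimately show ?thesis by blast
qed

text \<open>A fixed choice of the distance in \<open>approx_equicont\<close>, so that estimates for
  the approximations and for their limit share it.\<close>

definition "modulus R e = (SOME \<epsilon>. \<epsilon> > 0 \<and> (\<forall>n t x y. 0 \<le> t \<longrightarrow> t \<le> T \<longrightarrow> x \<in> {0..R} \<longrightarrow> y \<in> {0..R} \<longrightarrow> \<bar>x - y\<bar> < \<epsilon> \<longrightarrow>
    \<bar>hderiv (approx f T n a b t) x - hderiv (approx f T n a b t) y\<bar> \<le> e))"

lemma modulus:
  assumes "0 \<le> R" "0 < e"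
  shows "0 < modulus R e"
    "\<lbrakk>0 \<le> t; t \<le> T; x \<in> {0..R}; y \<in> {0..R}; \<bar>x - y\<bar> < modulus R e\<rbrakk> \<Longrightarrow>
      \<bar>hderiv (approx f T n a b t) x - hderiv (approx f T n a b t) y\<bar> \<le> e"
  using someI_ex[OF approx_equicont[OF assms]] unfolding modulus_def[symmetric] by blast+

lemma approx_taylor:
  assumes "0 \<le> R" "0 < e" "0 \<le> t" "t \<le> T" "x \<in> {0..R}" "y \<in> {0..R}" "\<bar>x - y\<bar> < modulus R e"
  shows "\<bar>approx f T n a b t y - approx f T n a b t x - hderiv (approx f T n a b t) x * (y - x)\<bar> \<le> e * \<bar>y - x\<bar>"
proof (rule taylor_bound)
  fix z assume z: "z \<in> closed_segment x y"
  then have "z \<in> {0..R}" "\<bar>z - x\<bar> \<le> \<bar>x - y\<bar>"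
    using assms by (auto simp: closed_segment_eq_real_ivl split: if_splits)
  then show "\<bar>hderiv (approx f T n a b t) z - hderiv (approx f T n a b t) x\<bar> \<le> e"
    using assms by (intro modulus(2)[OF assms(1,2)]) auto
qed (use assms tameD(4)[OF approx_tame] in auto)

text \<open>The exponential term is the accumulated error of halving the step; the other term pays
  for one extra fine step when the time index is rounded down.\<close>

definition "rate = T * (exp (T * M) * (T * (2 * M * (M\<^sup>2 + B))) + (M\<^sup>2 + B))"

lemma approx_Suc:
  assumes t: "0 \<le> t" "t \<le> T" and x: "0 \<le> x"
  shows "\<bar>approx f T (Suc n) a b t x - approx f T n a b t x\<bar> \<le> rate / 2 ^ n"
proof -
  define d where "d = step (Suc n)"
  define k where "k = index n t"
  define k' where "k' = index (Suc n) t"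
  have d2: "step n = 2 * d" by (simp add: d_def step_def)
  have d: "0 < d" using step_pos by (simp add: d_def)
  have k: "real k * (2 * d) \<le> t" "t < (real k + 1) * (2 * d)"
    using index[OF t(1), of n] by (simp_all add: k_def d2)
  have k': "real k' * d \<le> t" "t < (real k' + 1) * d"
    using index[OF t(1), of "Suc n"] by (simp_all add: k'_def d_def)
  have "(2 * real k) * d < (real k' + 1) * d" "real k' * d < (2 * real k + 2) * d"
    using k k' by (simp_all add: algebra_simps)
  then have "2 * real k < real k' + 1" "real k' < 2 * real k + 2"
    using d by simp_all
  \<comment> \<open>\<open>t\<close> lies between \<open>2 * k * d\<close> and
    \<open>(2 * k + 2) * d\<close>, so the finer approximation has performed at most one additional
    step.\<close>
  then have kk: "k' = 2 * k \<or> k' = 2 * k + 1" by linarith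
  let ?K = "2 * M * (M\<^sup>2 + B)"
  have K: "0 \<le> ?K" "0 \<le> M\<^sup>2 + B" using M_nonneg B_nonneg by auto
  have kT: "real k * (2 * d) \<le> T" "real k' * d \<le> T" using k k' t by auto
  have "real k * (2 * d * M) \<le> T * M"
    using mult_right_mono[OF kT(1) M_nonneg] by (simp add: mult.assoc)
  then have p: "(1 + 2 * d * M) ^ k \<le> exp (T * M)"
    using d M_nonneg by (intro one_plus_power_le_exp) auto
  have "real k * d \<le> real k * (2 * d)" using d by (intro mult_left_mono) auto
  then have "real k * d \<le> T" using kT(1) by linarith
  then have "(real k * d) * (?K * d) \<le> T * (?K * d)" using K d by (intro mult_right_mono) auto
  then have q: "real k * (?K * d\<^sup>2) \<le> T * ?K * d" by (simp add: power2_eq_square mult_ac)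
  have "\<bar>scheme f (2 * d) k a b x - scheme f d (2 * k) a b x\<bar> \<le> (1 + 2 * d * M) ^ k * (real k * (?K * d\<^sup>2))"
    using d by (intro scheme_halve[OF tame_a tame_b _ kT(1) M x]) auto
  also have "\<dots> \<le> exp (T * M) * (T * ?K * d)"
    by (rule mult_mono[OF p q]) (use K in simp_all)
  finally have 1: "\<bar>scheme f (2 * d) k a b x - scheme f d (2 * k) a b x\<bar> \<le> exp (T * M) * (T * ?K * d)" .
  have 2: "\<bar>scheme f d k' a b x - scheme f d (2 * k) a b x\<bar> \<le> d * (M\<^sup>2 + B)"
    using kk
  proof
    assume "k' = 2 * k"
    then show ?thesis using d K(2) by simp
  next
    assume k'2: "k' = 2 * k + 1"
    then have "real (2 * k + 1) * d \<le> T" using kT(2) by simp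
    from scheme_diff[OF tame_a tame_b _ this M x] d
    show ?thesis unfolding k'2 by simp
  qed
  have "\<bar>approx f T (Suc n) a b t x - approx f T n a b t x\<bar> = \<bar>scheme f d k' a b x - scheme f (2 * d) k a b x\<bar>"
    by (simp add: approx_eq k_def k'_def d_def[symmetric] d2)
  also have "\<dots> \<le> exp (T * M) * (T * ?K * d) + d * (M\<^sup>2 + B)" using 1 2 by linarith
  also have "\<dots> = rate / 2 ^ n / 2" by (simp add: rate_def d_def step_def field_simps)
  also have "\<dots> \<le> rate / 2 ^ n"
  proof -
    have "0 \<le> rate" unfolding rate_def using T_pos K M_nonneg B_nonneg by (intro mult_nonneg_nonneg add_nonneg_nonneg) auto
    then have "0 \<le> rate / 2 ^ n" by simp
    moreover have "y / 2 \<le> y" if "0 \<le> y" for y :: real using that by simp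
    ultimately show ?thesis by blast
  qed
  finally show ?thesis .
qed

section \<open>The limit and its derivative in space\<close>

lemma approx_sol:
  assumes "0 \<le> t" "t \<le> T" "0 \<le> x"
  shows "\<bar>sol f T a b t x - approx f T n a b t x\<bar> \<le> 2 * rate / 2 ^ n"
    "(\<lambda>n. approx f T n a b t x) \<longlonglongrightarrow> sol f T a b t x"
  unfolding sol_def using geometric_limit[of "\<lambda>n. approx f T n a b t x" rate] approx_Suc[OF assms] by auto

lemma sol_bounds:
  assumes "0 \<le> t" "t \<le> T" "0 \<le> x"
  shows "sol f T a b t x \<le> 0" "\<bar>sol f T a b t x\<bar> \<le> M"
proof -
  note lim = approx_sol(2)[OF assms] and tm = approx_tame[OF assms(1,2)]
  show "sol f T a b t x \<le> 0"
    by (rule tendsto_upperbound[OF lim]) (use tameD(1)[OF tm assms(3)] in simp_all)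
  show "\<bar>sol f T a b t x\<bar> \<le> M"
    by (rule tendsto_upperbound[OF tendsto_rabs[OF lim]]) (use tameD(2)[OF tm assms(3)] in simp_all)
qed

lemma step_small: "0 < e \<Longrightarrow> \<exists>N. \<forall>n\<ge>N. step n < e"
  unfolding step_def by (rule two_power_small)

lemma step_tendsto_0: "step \<longlonglongrightarrow> 0"
proof (rule LIMSEQ_I)
  fix r :: real assume "0 < r"
  then obtain N where "\<forall>n\<ge>N. step n < r" using step_small by blast
  then show "\<exists>no. \<forall>n\<ge>no. norm (step n - 0) < r"
    using step_pos by (intro exI[of _ N]) (simp add: abs_of_pos)
qed

lemma index_mono: "s \<le> t \<Longrightarrow> index n s \<le> index n t"
  unfolding index_def using step_pos[of n] by (intro nat_mono floor_mono divide_right_mono) auto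

lemma index_diff:
  assumes "0 \<le> s" "s \<le> t"
  shows "\<bar>real (index n t - index n s) * step n - (t - s)\<bar> \<le> step n"
  using index[OF assms(1), of n] index[OF order_trans[OF assms], of n] index_mono[OF assms(2), of n]
  by (simp add: of_nat_diff algebra_simps abs_le_iff)

text \<open>The approximations jump at grid times, so they satisfy the bound only up to one
  additional \<open>step n\<close>, which disappears in the limit.\<close>

lemma sol_time_lipschitz:
  assumes "0 \<le> s" "s \<le> T" "0 \<le> t" "t \<le> T" "0 \<le> x"
  shows "\<bar>sol f T a b t x - sol f T a b s x\<bar> \<le> (M\<^sup>2 + B) * \<bar>t - s\<bar>"
proof -
  have *: "\<bar>sol f T a b t x - sol f T a b s x\<bar> \<le> (M\<^sup>2 + B) * \<bar>t - s\<bar>" if "0 \<le> s" "s \<le> t" "t \<le> T" for s t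
  proof -
    have st: "0 \<le> t" "s \<le> T" using that by auto
    have K: "0 \<le> M\<^sup>2 + B" using B_nonneg by simp
    have "\<bar>approx f T n a b t x - approx f T n a b s x\<bar> \<le> (M\<^sup>2 + B) * (t - s + step n)" for n
    proof -
      define j where "j = index n t - index n s"
      have j: "index n t = index n s + j" using index_mono[OF that(2)] by (simp add: j_def)
      have jd: "real j * step n \<le> t - s + step n" using index_diff[OF that(1,2), of n] by (simp add: j_def abs_le_iff)
      have "real (index n s + j) * step n \<le> T" using index(1)[OF st(1), of n] that j by simp
      from scheme_diff[OF tame_a tame_b _ this M assms(5)] step_pos[of n]
      have "\<bar>approx f T n a b t x - approx f T n a b s x\<bar> \<le> real j * step n * (M\<^sup>2 + B)"
        by (simp add: approx_eq j)
      also have "\<dots> \<le> (t - s + step n) * (M\<^sup>2 + B)" using jd K by (rule mult_right_mono)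
      finally show ?thesis by (simp add: mult.commute)
    qed
    moreover have "(\<lambda>n. \<bar>approx f T n a b t x - approx f T n a b s x\<bar>) \<longlonglongrightarrow> \<bar>sol f T a b t x - sol f T a b s x\<bar>"
      by (intro tendsto_rabs tendsto_diff approx_sol that st assms)
    moreover have "(\<lambda>n. (M\<^sup>2 + B) * (t - s + step n)) \<longlonglongrightarrow> (M\<^sup>2 + B) * (t - s + 0)"
      by (intro tendsto_mult tendsto_add tendsto_const step_tendsto_0)
    ultimately have "\<bar>sol f T a b t x - sol f T a b s x\<bar> \<le> (M\<^sup>2 + B) * (t - s + 0)"
      by (intro LIMSEQ_le) auto
    then show ?thesis using that by simp
  qed
  show ?thesis
    using *[of s t] *[of t s] assms by (cases "s \<le> t") (auto simp: abs_minus_commute)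
qed

lemma sol_initial: "sol f T a b 0 x = a x"
  by (simp add: sol_def approx_def)

text \<open>Over a fixed length, the difference quotient is close to the derivative for all
  \<open>n\<close> at once, and the quotients converge because the values do. The length is chosen
  before \<open>N\<close>. Two Taylor errors of \<open>e / 4\<close> and four errors in values of
  \<open>e / 8\<close>, relative to that length, add up to \<open>e\<close>.\<close>

lemma approx_deriv_cauchy:
  assumes R: "0 \<le> R" and e: "0 < e"
  shows "\<exists>N. \<forall>n\<ge>N. \<forall>m\<ge>N. \<forall>t x. 0 \<le> t \<longrightarrow> t \<le> T \<longrightarrow> 0 \<le> x \<longrightarrow> x \<le> R \<longrightarrow>
    \<bar>hderiv (approx f T n a b t) x - hderiv (approx f T m a b t) x\<bar> \<le> e"
proof -
  have R1: "0 \<le> R + 1" and e4: "0 < e / 4" using R e by auto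
  \<comment> \<open>Half of the modulus gives a strict inequality, and the cap 1 keeps
    \<open>x + \<eta>\<close> within \<open>R + 1\<close>. The quotient is taken to the right and so
    stays in the half-line.\<close>
  define \<eta> where "\<eta> = min (modulus (R + 1) (e / 4) / 2) 1"
  have \<eta>: "0 < \<eta>" "\<eta> < modulus (R + 1) (e / 4)" "\<eta> \<le> 1"
    using modulus(1)[OF R1 e4] by (auto simp: \<eta>_def)
  have "0 < e * \<eta> / 8" using \<eta> e by simp
  then obtain N where N: "\<And>n. n \<ge> N \<Longrightarrow> 2 * rate / 2 ^ n < e * \<eta> / 8"
    using two_power_small by blast
  have "\<bar>hderiv (approx f T n a b t) x - hderiv (approx f T m a b t) x\<bar> \<le> e"
    if nm: "n \<ge> N" "m \<ge> N" and t: "0 \<le> t" "t \<le> T" and x: "0 \<le> x" "x \<le> R" for n m t x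
  proof -
    let ?p = "\<lambda>n. hderiv (approx f T n a b t) x"
    have y: "0 \<le> x + \<eta>" using x \<eta> by simp
    have tay: "\<bar>approx f T n a b t (x + \<eta>) - approx f T n a b t x - ?p n * \<eta>\<bar> \<le> e * \<eta> / 4" for n
      using approx_taylor[OF R1 e4 t, of x "x + \<eta>" n] x \<eta> by simp
    have cl: "\<bar>sol f T a b t z - approx f T n a b t z\<bar> \<le> e * \<eta> / 8" if "n \<ge> N" "0 \<le> z" for n z
      using approx_sol(1)[OF t that(2), of n] N[OF that(1)] by linarith
    have "\<bar>?p n * \<eta> - ?p m * \<eta>\<bar> \<le> e * \<eta>"
      using tay[of n] tay[of m] cl[OF nm(1) y] cl[OF nm(2) y] cl[OF nm(1) x(1)] cl[OF nm(2) x(1)]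
      unfolding abs_le_iff by (intro conjI; linarith)
    then have "\<bar>?p n - ?p m\<bar> * \<eta> \<le> e * \<eta>" using \<eta> by (simp add: abs_mult flip: left_diff_distrib)
    then show ?thesis using \<eta> by simp
  qed
  then show ?thesis by blast
qed

lemma approx_deriv_lim:
  assumes "0 \<le> t" "t \<le> T" "0 \<le> x"
  shows "(\<lambda>n. hderiv (approx f T n a b t) x) \<longlonglongrightarrow> solx f T a b t x"
proof -
  have "Cauchy (\<lambda>n. hderiv (approx f T n a b t) x)"
  proof (rule metric_CauchyI)
    fix e :: real assume "0 < e"
    then have "0 < e / 2" by simp
    then obtain N where "\<forall>n\<ge>N. \<forall>m\<ge>N. \<bar>hderiv (approx f T n a b t) x - hderiv (approx f T m a b t) x\<bar> \<le> e / 2"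
      using approx_deriv_cauchy[OF assms(3)] assms by blast
    then show "\<exists>N. \<forall>m\<ge>N. \<forall>n\<ge>N. dist (hderiv (approx f T m a b t) x) (hderiv (approx f T n a b t) x) < e"
      using \<open>0 < e\<close> unfolding dist_real_def by (intro exI[of _ N]) force
  qed
  then show ?thesis unfolding solx_def by (simp add: Cauchy_convergent_iff convergent_LIMSEQ_iff)
qed

text \<open>Uniformity in \<open>t\<close> is required because the argument for the time derivative
  lets \<open>n\<close> and the time vary together.\<close>

lemma approx_deriv_uniform:
  assumes x: "0 \<le> x" and e: "0 < e"
  shows "\<exists>N. \<forall>n\<ge>N. \<forall>t. 0 \<le> t \<longrightarrow> t \<le> T \<longrightarrow> \<bar>hderiv (approx f T n a b t) x - solx f T a b t x\<bar> \<le> e"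
proof -
  obtain N where N: "\<And>n m t. n \<ge> N \<Longrightarrow> m \<ge> N \<Longrightarrow> 0 \<le> t \<Longrightarrow> t \<le> T \<Longrightarrow>
      \<bar>hderiv (approx f T n a b t) x - hderiv (approx f T m a b t) x\<bar> \<le> e"
    using approx_deriv_cauchy[OF assms] x by blast
  have "\<bar>hderiv (approx f T n a b t) x - solx f T a b t x\<bar> \<le> e" if "n \<ge> N" "0 \<le> t" "t \<le> T" for n t
  proof (rule tendsto_upperbound)
    show "(\<lambda>m. \<bar>hderiv (approx f T n a b t) x - hderiv (approx f T m a b t) x\<bar>)
        \<longlonglongrightarrow> \<bar>hderiv (approx f T n a b t) x - solx f T a b t x\<bar>"
      by (intro tendsto_rabs tendsto_diff tendsto_const approx_deriv_lim that x)
    show "\<forall>\<^sub>F m in sequentially. \<bar>hderiv (approx f T n a b t) x - hderiv (approx f T m a b t) x\<bar> \<le> e"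
      using N[OF that(1) _ that(2,3)] unfolding eventually_sequentially by blast
  qed simp
  then show ?thesis by blast
qed

lemma solx_bound:
  assumes "0 \<le> t" "t \<le> T" "0 \<le> x"
  shows "\<bar>solx f T a b t x\<bar> \<le> M"
  by (rule tendsto_upperbound[OF tendsto_rabs[OF approx_deriv_lim[OF assms]]])
    (use tameD(3)[OF approx_tame[OF assms(1,2)] assms(3)] in simp_all)

text \<open>The modulus does not depend on \<open>n\<close>, so the inequalities for the
  approximations pass to the limit.\<close>

lemma sol_modulus:
  assumes "0 \<le> R" "0 < e" "0 \<le> t" "t \<le> T" "x \<in> {0..R}" "y \<in> {0..R}" "\<bar>x - y\<bar> < modulus R e"
  shows "\<bar>solx f T a b t x - solx f T a b t y\<bar> \<le> e"
    "\<bar>sol f T a b t y - sol f T a b t x - solx f T a b t x * (y - x)\<bar> \<le> e * \<bar>y - x\<bar>"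
proof -
  have xy: "0 \<le> x" "0 \<le> y" using assms by auto
  have "(\<lambda>n. \<bar>hderiv (approx f T n a b t) x - hderiv (approx f T n a b t) y\<bar>)
      \<longlonglongrightarrow> \<bar>solx f T a b t x - solx f T a b t y\<bar>"
    by (intro tendsto_rabs tendsto_diff approx_deriv_lim assms xy)
  then show "\<bar>solx f T a b t x - solx f T a b t y\<bar> \<le> e"
    by (rule tendsto_upperbound) (simp_all add: modulus(2)[OF assms])
  have "(\<lambda>n. \<bar>approx f T n a b t y - approx f T n a b t x - hderiv (approx f T n a b t) x * (y - x)\<bar>)
      \<longlonglongrightarrow> \<bar>sol f T a b t y - sol f T a b t x - solx f T a b t x * (y - x)\<bar>"
    by (intro tendsto_rabs tendsto_diff tendsto_mult tendsto_const approx_deriv_lim approx_sol assms xy)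
  then show "\<bar>sol f T a b t y - sol f T a b t x - solx f T a b t x * (y - x)\<bar> \<le> e * \<bar>y - x\<bar>"
    by (rule tendsto_upperbound) (simp_all add: approx_taylor[OF assms])
qed

end

lemma continuous_on_lipschitz_pair:
  fixes g :: "real \<Rightarrow> real \<Rightarrow> real"
  assumes "\<And>t x s y. (t, x) \<in> S \<Longrightarrow> (s, y) \<in> S \<Longrightarrow> \<bar>g t x - g s y\<bar> \<le> K * \<bar>t - s\<bar> + L * \<bar>x - y\<bar>"
    and "0 \<le> K" "0 \<le> L"
  shows "continuous_on S (\<lambda>(t, x). g t x)"
proof (rule lipschitz_on_continuous_on)
  show "(K + L)-lipschitz_on S (\<lambda>(t, x). g t x)"
  proof (rule lipschitz_onI)
    fix p q assume "p \<in> S" "q \<in> S"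
    then have "dist (case p of (t, x) \<Rightarrow> g t x) (case q of (t, x) \<Rightarrow> g t x)
        \<le> K * dist (fst p) (fst q) + L * dist (snd p) (snd q)"
      using assms(1) by (auto simp: dist_real_def split: prod.splits)
    also have "\<dots> \<le> K * dist p q + L * dist p q"
      using assms(2,3) by (intro add_mono mult_left_mono dist_fst_le dist_snd_le)
    finally show "dist (case p of (t, x) \<Rightarrow> g t x) (case q of (t, x) \<Rightarrow> g t x) \<le> (K + L) * dist p q"
      by (simp add: algebra_simps)
  qed (use assms in simp)
qed

context riemann
begin

lemma sol_deriv_x:
  assumes t: "0 \<le> t" "t \<le> T" and x: "0 \<le> x"
  shows "(sol f T a b t has_real_derivative solx f T a b t x) (at x within {0..})"
  unfolding has_field_derivative_def has_derivative_within_alt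
proof (intro conjI allI impI)
  show "bounded_linear ((*) (solx f T a b t x))" by (rule bounded_linear_mult_right)
  fix e :: real assume e: "0 < e"
  have R: "0 \<le> x + 1" using x by simp
  show "\<exists>d>0. \<forall>y\<in>{0..}. norm (y - x) < d \<longrightarrow>
      norm (sol f T a b t y - sol f T a b t x - solx f T a b t x * (y - x)) \<le> e * norm (y - x)"
  proof (intro exI[of _ "min 1 (modulus (x + 1) e)"] conjI ballI impI)
    show "0 < min 1 (modulus (x + 1) e)" using modulus(1)[OF R e] by simp
    fix y :: real assume "y \<in> {0..}" "norm (y - x) < min 1 (modulus (x + 1) e)"
    then show "norm (sol f T a b t y - sol f T a b t x - solx f T a b t x * (y - x)) \<le> e * norm (y - x)"
      using sol_modulus(2)[OF R e t, of x y] x by (auto simp: abs_minus_commute)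
  qed
qed

lemma sol_lipschitz:
  assumes "0 \<le> t" "t \<le> T" "0 \<le> x" "0 \<le> y"
  shows "\<bar>sol f T a b t x - sol f T a b t y\<bar> \<le> M * \<bar>x - y\<bar>"
  using lipschitz_of_deriv_bound[of "sol f T a b t" "solx f T a b t" M x y] sol_deriv_x solx_bound assms by blast

lemma sol_continuous: "continuous_on ({0..T} \<times> {0..}) (\<lambda>(t, x). sol f T a b t x)"
proof (rule continuous_on_lipschitz_pair)
  fix t x s y :: real assume "(t, x) \<in> {0..T} \<times> {0..}" "(s, y) \<in> {0..T} \<times> {0..}"
  then show "\<bar>sol f T a b t x - sol f T a b s y\<bar> \<le> (M\<^sup>2 + B) * \<bar>t - s\<bar> + M * \<bar>x - y\<bar>"
    using sol_time_lipschitz[of s t x] sol_lipschitz[of s x y] by auto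
qed (use M_nonneg B_nonneg in auto)

text \<open>In \<open>x\<close> the modulus applies directly. In \<open>t\<close> only the values
  are under control, so the derivative is again replaced by a difference quotient:
  \<open>e / 5\<close> for the change of \<open>x\<close>, two Taylor errors of \<open>e / 5\<close>
  and two time errors of \<open>e / 10\<close> leave a total below \<open>e\<close>.\<close>

lemma solx_continuous: "continuous_on ({0..T} \<times> {0..}) (\<lambda>(t, x). solx f T a b t x)"
  unfolding continuous_on_iff
proof (intro ballI allI impI)
  fix p :: "real \<times> real" and e :: real assume "p \<in> {0..T} \<times> {0..}" and e: "0 < e"
  then obtain t0 x0 where p: "p = (t0, x0)" "0 \<le> t0" "t0 \<le> T" "0 \<le> x0" by auto
  have R: "0 \<le> x0 + 1" and e4: "0 < e / 5" using p e by auto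
  define \<eta> where "\<eta> = min (modulus (x0 + 1) (e / 5) / 2) 1"
  have \<eta>: "0 < \<eta>" "\<eta> < modulus (x0 + 1) (e / 5)" "\<eta> \<le> 1"
    using modulus(1)[OF R e4] by (auto simp: \<eta>_def)
  define K where "K = M\<^sup>2 + B + 1"
  have K: "0 < K" "M\<^sup>2 + B \<le> K" using B_nonneg by (auto simp: K_def add_nonneg_pos)
  define d where "d = min \<eta> (e * \<eta> / (10 * K))"
  have d: "0 < d" using \<eta> e K by (simp add: d_def)
  have "\<bar>solx f T a b t x - solx f T a b t0 x0\<bar> < e"
    if t: "0 \<le> t" "t \<le> T" and x: "0 \<le> x" and dx: "\<bar>x - x0\<bar> < d" and dt: "\<bar>t - t0\<bar> < d" for t x
  proof -
    have x1: "x \<in> {0..x0 + 1}" "x0 \<in> {0..x0 + 1}" "x0 + \<eta> \<in> {0..x0 + 1}" "0 \<le> x0 + \<eta>" using x p dx \<eta> by (auto simp: d_def)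
    have 1: "\<bar>solx f T a b t x - solx f T a b t x0\<bar> \<le> e / 5"
      using dx \<eta> by (intro sol_modulus(1)[OF R e4 t x1(1,2)]) (auto simp: d_def)
    have tay: "\<bar>sol f T a b s (x0 + \<eta>) - sol f T a b s x0 - solx f T a b s x0 * \<eta>\<bar> \<le> e * \<eta> / 5"
      if "0 \<le> s" "s \<le> T" for s
      using sol_modulus(2)[OF R e4 that x1(2,3)] \<eta> by simp
    have tl: "\<bar>sol f T a b t y - sol f T a b t0 y\<bar> \<le> e * \<eta> / 10" if "0 \<le> y" for y
    proof -
      have "\<bar>sol f T a b t y - sol f T a b t0 y\<bar> \<le> (M\<^sup>2 + B) * \<bar>t - t0\<bar>"
        using t p that by (intro sol_time_lipschitz) auto
      also have "\<dots> \<le> K * (e * \<eta> / (10 * K))" using K B_nonneg dt by (intro mult_mono) (auto simp: d_def)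
      finally show ?thesis using K by simp
    qed
    have "\<bar>solx f T a b t x0 * \<eta> - solx f T a b t0 x0 * \<eta>\<bar> \<le> e * \<eta> * (3 / 5)"
      using tay[OF t] tay[OF p(2,3)] tl[OF x1(4)] tl[OF p(4)]
      unfolding abs_le_iff by (intro conjI; linarith)
    then have "\<bar>solx f T a b t x0 - solx f T a b t0 x0\<bar> * \<eta> \<le> (e * (3 / 5)) * \<eta>"
      using \<eta> by (simp add: abs_mult flip: left_diff_distrib)
    then have "\<bar>solx f T a b t x0 - solx f T a b t0 x0\<bar> \<le> e * (3 / 5)" using \<eta> by simp
    then show ?thesis using 1 e by linarith
  qed
  moreover have "\<bar>fst q - t0\<bar> < d" "\<bar>snd q - x0\<bar> < d" if "dist q p < d" for q
    using that dist_fst_le[of q p] dist_snd_le[of q p] by (auto simp: p dist_real_def)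
  ultimately show "\<exists>d>0. \<forall>q\<in>{0..T} \<times> {0..}. dist q p < d \<longrightarrow>
      dist (case q of (t, x) \<Rightarrow> solx f T a b t x) (case p of (t, x) \<Rightarrow> solx f T a b t x) < e"
    using d by (intro exI[of _ d]) (auto simp: p dist_real_def)
qed

definition "near t0 = sequentially \<times>\<^sub>F inf (nhds t0) (principal {0..T})"

lemma eventually_nearI:
  assumes "0 < \<theta>" "\<And>n s. n \<ge> N \<Longrightarrow> 0 \<le> s \<Longrightarrow> s \<le> T \<Longrightarrow> \<bar>s - t0\<bar> < \<theta> \<Longrightarrow> P (n, s)"
  shows "eventually P (near t0)"
proof -
  have "eventually (\<lambda>n. n \<ge> N) sequentially" by (rule eventually_ge_at_top)
  moreover have "eventually (\<lambda>s. s \<in> {0..T} \<and> \<bar>s - t0\<bar> < \<theta>) (inf (nhds t0) (principal {0..T}))"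
    unfolding eventually_inf_principal eventually_nhds_metric
    using assms(1) by (auto simp: dist_real_def)
  ultimately show ?thesis
    unfolding near_def by (rule eventually_prodI[THEN eventually_mono]) (use assms(2) in auto)
qed

lemma eventually_nearD:
  assumes "eventually P (near t0)"
  obtains N \<theta> where "0 < \<theta>" "\<And>n s. n \<ge> N \<Longrightarrow> 0 \<le> s \<Longrightarrow> s \<le> T \<Longrightarrow> \<bar>s - t0\<bar> < \<theta> \<Longrightarrow> P (n, s)"
proof -
  obtain Q S where QS: "eventually Q sequentially" "eventually S (inf (nhds t0) (principal {0..T}))"
    "\<And>n s. Q n \<Longrightarrow> S s \<Longrightarrow> P (n, s)"
    using assms unfolding near_def eventually_prod_filter by blast
  obtain N where "\<And>n. n \<ge> N \<Longrightarrow> Q n" using QS(1) by (auto simp: eventually_sequentially)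
  moreover obtain \<theta> where "0 < \<theta>" "\<And>s. \<bar>s - t0\<bar> < \<theta> \<Longrightarrow> 0 \<le> s \<Longrightarrow> s \<le> T \<Longrightarrow> S s"
    using QS(2) unfolding eventually_inf_principal eventually_nhds_metric by (auto simp: dist_real_def)
  ultimately show ?thesis using that[of \<theta> N] QS(3) by blast
qed

lemma approx_near:
  assumes t0: "0 \<le> t0" "t0 \<le> T" and x: "0 \<le> x"
  shows "((\<lambda>(n, s). approx f T n a b s x) \<longlongrightarrow> sol f T a b t0 x) (near t0)"
proof (rule tendstoI)
  fix e :: real assume e: "0 < e"
  then have "0 < e / 2" by simp
  then obtain N where N: "\<And>n. n \<ge> N \<Longrightarrow> 2 * rate / 2 ^ n < e / 2" using two_power_small by blast
  define K where "K = M\<^sup>2 + B + 1"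
  have K: "0 < K" "M\<^sup>2 + B \<le> K" using B_nonneg by (auto simp: K_def add_nonneg_pos)
  show "\<forall>\<^sub>F p in near t0. dist (case p of (n, s) \<Rightarrow> approx f T n a b s x) (sol f T a b t0 x) < e"
  proof (rule eventually_nearI[of "e / (2 * K)" N])
    show "0 < e / (2 * K)" using e K by simp
    fix n s assume n: "n \<ge> N" and s: "0 \<le> s" "s \<le> T" and d: "\<bar>s - t0\<bar> < e / (2 * K)"
    have "\<bar>sol f T a b s x - sol f T a b t0 x\<bar> \<le> (M\<^sup>2 + B) * \<bar>s - t0\<bar>"
      by (rule sol_time_lipschitz[OF t0 s x])
    also have "\<dots> \<le> K * (e / (2 * K))" using K d B_nonneg by (intro mult_mono) auto
    also have "\<dots> = e / 2" using K by simp
    finally have "\<bar>approx f T n a b s x - sol f T a b t0 x\<bar> < e"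
      using approx_sol(1)[OF s x, of n] N[OF n] by linarith
    then show "dist (case (n, s) of (n, s) \<Rightarrow> approx f T n a b s x) (sol f T a b t0 x) < e"
      by (simp add: dist_real_def)
  qed
qed

lemma approx_deriv_near:
  assumes t0: "0 \<le> t0" "t0 \<le> T" and x: "0 \<le> x"
  shows "((\<lambda>(n, s). hderiv (approx f T n a b s) x) \<longlongrightarrow> solx f T a b t0 x) (near t0)"
proof (rule tendstoI)
  fix e :: real assume e: "0 < e"
  then have e2: "0 < e / 2" by simp
  then obtain N where N: "\<And>n t. n \<ge> N \<Longrightarrow> 0 \<le> t \<Longrightarrow> t \<le> T \<Longrightarrow> \<bar>hderiv (approx f T n a b t) x - solx f T a b t x\<bar> \<le> e / 2"
    using approx_deriv_uniform[OF x] by blast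
  have "continuous_on {0..T} (\<lambda>t. (\<lambda>(t, x). solx f T a b t x) (t, x))"
    by (rule continuous_on_compose2[OF solx_continuous]) (use x in \<open>auto intro!: continuous_intros\<close>)
  then have "continuous_on {0..T} (\<lambda>t. solx f T a b t x)" by simp
  then obtain \<theta> where \<theta>: "0 < \<theta>" "\<And>s. 0 \<le> s \<Longrightarrow> s \<le> T \<Longrightarrow> \<bar>s - t0\<bar> < \<theta> \<Longrightarrow> \<bar>solx f T a b s x - solx f T a b t0 x\<bar> < e / 2"
    using e2 t0 unfolding continuous_on_iff dist_real_def by (metis atLeastAtMost_iff)
  show "\<forall>\<^sub>F p in near t0. dist (case p of (n, s) \<Rightarrow> hderiv (approx f T n a b s) x) (solx f T a b t0 x) < e"
  proof (rule eventually_nearI[of \<theta> N])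
    fix n s assume n: "n \<ge> N" and s: "0 \<le> s" "s \<le> T" "\<bar>s - t0\<bar> < \<theta>"
    then have "\<bar>hderiv (approx f T n a b s) x - solx f T a b t0 x\<bar> < e"
      using N[OF n s(1,2)] \<theta>(2)[OF s] by linarith
    then show "dist (case (n, s) of (n, s) \<Rightarrow> hderiv (approx f T n a b s) x) (solx f T a b t0 x) < e"
      by (simp add: dist_real_def)
  qed (rule \<theta>)
qed

text \<open>Identifies the limit of the increment of the scheme per unit of time, at any grid times
  that approach \<open>t0\<close>.\<close>

lemma velocity_near:
  assumes t0: "0 \<le> t0" "t0 \<le> T" and x: "0 \<le> x"
  shows "((\<lambda>(n, s). f x - speed (approx f T n a b s) (approx f T n b a s) x * hderiv (approx f T n a b s) x) \<longlongrightarrow>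
    f x - speed (sol f T a b t0) (sol f T b a t0) x * solx f T a b t0 x) (near t0)"
proof -
  note 1 = approx_near[OF assms] and 2 = riemann.approx_near[OF swap assms] and 3 = approx_deriv_near[OF assms]
  show ?thesis
    unfolding speed_def case_prod_unfold
    by (intro tendsto_diff tendsto_mult tendsto_divide tendsto_add tendsto_const
        1[unfolded case_prod_unfold] 2[unfolded case_prod_unfold] 3[unfolded case_prod_unfold]) simp
qed

text \<open>The source cancels, and what remains is the Taylor remainder of the current
  approximation between \<open>x\<close> and its foot. At the grid time \<open>s\<close> the
  approximation is exactly the iterate number \<open>k\<close>.\<close>

lemma one_step:
  assumes e: "0 < e" and x: "0 \<le> x" and small: "step n * M < modulus (x + T * M) e"
    and k: "real k * step n \<le> T"
  defines "s \<equiv> real k * step n"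
  shows "\<bar>scheme f (step n) (Suc k) a b x - scheme f (step n) k a b x
    - step n * (f x - speed (approx f T n a b s) (approx f T n b a s) x * hderiv (approx f T n a b s) x)\<bar>
    \<le> e * (step n * M)"
proof -
  let ?a = "approx f T n a b s" and ?b = "approx f T n b a s" and ?d = "step n"
  have s: "0 \<le> s" "s \<le> T" using k step_pos[of n] by (auto simp: s_def)
  have eq: "scheme f ?d k a b = ?a" "scheme f ?d k b a = ?b"
    by (simp_all add: approx_eq s_def index_grid)
  have tm: "tame M ?a" "tame M ?b" using approx_tame[OF s] riemann.approx_tame[OF swap s] .
  let ?y = "x - ?d * speed ?a ?b x"
  have d: "0 \<le> ?d" using step_pos less_imp_le by blast
  have y: "x \<le> ?y" "?y \<le> x + ?d * M" using advance_foot[OF tm d x] by auto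
  have "?d \<le> T" using T_pos by (simp add: step_def field_simps)
  then have "?d * M \<le> T * M" using M_nonneg by (intro mult_right_mono)
  then have R: "0 \<le> x + T * M" "x \<in> {0..x + T * M}" "?y \<in> {0..x + T * M}" using x y d M_nonneg T_pos by auto
  have "\<bar>?a ?y - ?a x - hderiv ?a x * (?y - x)\<bar> \<le> e * \<bar>?y - x\<bar>"
    using y small by (intro approx_taylor[OF R(1) e s R(2,3)]) auto
  also have "\<dots> \<le> e * (?d * M)" using y e by (intro mult_left_mono) auto
  finally have "\<bar>?a ?y - ?a x - hderiv ?a x * (?y - x)\<bar> \<le> e * (?d * M)" .
  moreover have "scheme f ?d (Suc k) a b x - scheme f ?d k a b x - ?d * (f x - speed ?a ?b x * hderiv ?a x)
      = ?a ?y - ?a x - hderiv ?a x * (?y - x)"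
    by (simp add: eq advance_def algebra_simps)
  ultimately show ?thesis by simp
qed

text \<open>Telescoping: between two times near \<open>t0\<close> every step contributes
  \<open>step n * G\<close> up to a small multiple of \<open>step n\<close>. Summing and letting
  \<open>n\<close> grow compares the increment of \<open>sol\<close> with
  \<open>(t - s) * G\<close>. The estimate holds for ordered pairs of times, so taking
  \<open>t0\<close> as either end point covers both sides.\<close>

lemma sol_deriv_t:
  assumes t0: "0 \<le> t0" "t0 \<le> T" and x: "0 \<le> x"
  shows "((\<lambda>t. sol f T a b t x) has_real_derivative
    f x - speed (sol f T a b t0) (sol f T b a t0) x * solx f T a b t0 x) (at t0 within {0..T})"
  unfolding has_field_derivative_def has_derivative_within_alt
proof (intro conjI allI impI)
  define G where "G = f x - speed (sol f T a b t0) (sol f T b a t0) x * solx f T a b t0 x"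
  show "bounded_linear ((*) (f x - speed (sol f T a b t0) (sol f T b a t0) x * solx f T a b t0 x))"
    by (rule bounded_linear_mult_right)
  fix e0 :: real assume "0 < e0"
  define e where "e = e0 / 2"
  have e: "0 < e" using \<open>0 < e0\<close> by (simp add: e_def)
  from tendstoD[OF velocity_near[OF assms] this]
  obtain N1 \<theta> where \<theta>: "0 < \<theta>" and N1: "\<And>n s. n \<ge> N1 \<Longrightarrow> 0 \<le> s \<Longrightarrow> s \<le> T \<Longrightarrow> \<bar>s - t0\<bar> < \<theta> \<Longrightarrow>
      \<bar>f x - speed (approx f T n a b s) (approx f T n b a s) x * hderiv (approx f T n a b s) x - G\<bar> < e"
    by (rule eventually_nearD) (auto simp: dist_real_def G_def)
  \<comment> \<open>Chosen so that the remainder \<open>e' * (step n * M)\<close> in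
    \<open>one_step\<close> is at most \<open>step n * e\<close>.\<close>
  define e' where "e' = e / (M + 1)"
  have e': "0 < e'" using e M_nonneg by (simp add: e'_def)
  have e'M: "e' * M \<le> e" using e M_nonneg by (simp add: e'_def field_simps)
  define \<epsilon> where "\<epsilon> = modulus (x + T * M) e'"
  have \<epsilon>: "0 < \<epsilon>" unfolding \<epsilon>_def using x T_pos M_nonneg by (intro modulus(1) e') auto
  \<comment> \<open>The grid time preceding \<open>s\<close> may lie one step further from
    \<open>t0\<close> than \<open>s\<close> does, so \<open>\<theta>\<close> is split in half; the
    second bound keeps the displacement of the foot below the modulus.\<close>
  have "0 < min (\<theta> / 2) (\<epsilon> / (M + 1))" using \<epsilon> \<theta> M_nonneg by simp
  then obtain N2 where N2: "\<And>n. n \<ge> N2 \<Longrightarrow> step n < min (\<theta> / 2) (\<epsilon> / (M + 1))" using step_small by blast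
  have main: "\<bar>sol f T a b t x - sol f T a b s x - (t - s) * G\<bar> \<le> (2 * e) * (t - s)"
    if s: "0 \<le> s" "s \<le> t" "t \<le> T" and d: "\<bar>s - t0\<bar> < \<theta> / 2" "\<bar>t - t0\<bar> < \<theta> / 2" for s t
  proof -
    have st: "0 \<le> t" "s \<le> T" using s by auto
    have "\<bar>approx f T n a b t x - approx f T n a b s x - (t - s) * G\<bar> \<le> (2 * e) * (t - s) + step n * (2 * e + \<bar>G\<bar>)"
      if n: "n \<ge> max N1 N2" for n
    proof -
      let ?d = "step n" and ?k = "index n s"
      define j where "j = index n t - ?k"
      have j: "index n t = ?k + j" using index_mono[OF s(2)] by (simp add: j_def)
      have jd: "\<bar>real j * ?d - (t - s)\<bar> \<le> ?d" using index_diff[OF s(1,2), of n] by (simp add: j_def)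
      have d0: "0 < ?d" by (rule step_pos)
      have dn: "?d < \<theta> / 2" "?d < \<epsilon> / (M + 1)" using N2[of n] n by auto
      have "?d * M \<le> ?d * (M + 1)" using d0 by simp
      also have "\<dots> < \<epsilon>" using dn(2) M_nonneg by (simp add: pos_less_divide_eq)
      finally have dM: "?d * M < modulus (x + T * M) e'" by (simp add: \<epsilon>_def)
      have "\<bar>scheme f ?d (?k + i) a b x - scheme f ?d ?k a b x - real i * ?d * G\<bar> \<le> real i * ?d * (2 * e)"
        if "i \<le> j" for i
        using that
      proof (induction i)
        case (Suc i)
        let ?s = "real (?k + i) * ?d"
        have "real (?k + i) * ?d \<le> real (?k + j) * ?d" using Suc.prems d0 by (intro mult_right_mono) auto
        also have "\<dots> \<le> t" using index(1)[OF st(1), of n] j by simp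
        finally have st': "?s \<le> t" .
        have "s < (real ?k + 1) * ?d" by (rule index(2)[OF s(1)])
        also have "\<dots> \<le> ?s + ?d" using d0 by (simp add: algebra_simps)
        finally have "s < ?s + ?d" .
        then have near: "\<bar>?s - t0\<bar> < \<theta>" using st' d dn(1) by linarith
        have sT: "?s \<le> T" "0 \<le> ?s" using st' s d0 by auto
        let ?g = "f x - speed (approx f T n a b ?s) (approx f T n b a ?s) x * hderiv (approx f T n a b ?s) x"
        have "\<bar>?g - G\<bar> < e" using n by (intro N1 sT near) auto
        then have "\<bar>?d * (?g - G)\<bar> \<le> ?d * e" using d0 by (simp add: abs_mult)
        moreover have "\<bar>scheme f ?d (Suc (?k + i)) a b x - scheme f ?d (?k + i) a b x - ?d * ?g\<bar> \<le> e' * (?d * M)"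
          by (rule one_step[OF e' x dM sT(1)])
        moreover have "e' * (?d * M) \<le> ?d * e" using mult_left_mono[OF e'M, of ?d] d0 by (simp add: mult_ac)
        moreover have "real (Suc i) * ?d * G = real i * ?d * G + ?d * G" "real (Suc i) * ?d * (2 * e) = real i * ?d * (2 * e) + ?d * e + ?d * e"
          "?d * (?g - G) = ?d * ?g - ?d * G"
          by (simp_all add: algebra_simps)
        moreover have "\<bar>scheme f ?d (?k + i) a b x - scheme f ?d ?k a b x - real i * ?d * G\<bar> \<le> real i * ?d * (2 * e)"
          using Suc by simp
        ultimately show ?case unfolding add_Suc_right abs_le_iff by (intro conjI; linarith)
      qed simp
      from this[of j] have 1: "\<bar>approx f T n a b t x - approx f T n a b s x - real j * ?d * G\<bar> \<le> real j * ?d * (2 * e)"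
        by (simp add: approx_eq j)
      have "\<bar>(real j * ?d - (t - s)) * G\<bar> \<le> ?d * \<bar>G\<bar>" unfolding abs_mult using jd by (intro mult_right_mono) auto
      moreover have "real j * ?d * (2 * e) \<le> (t - s + ?d) * (2 * e)"
        using jd e by (intro mult_right_mono) auto
      moreover have "(real j * ?d - (t - s)) * G = real j * ?d * G - (t - s) * G"
        "(t - s + ?d) * (2 * e) = (2 * e) * (t - s) + ?d * (2 * e)" "?d * (2 * e + \<bar>G\<bar>) = ?d * (2 * e) + ?d * \<bar>G\<bar>"
        by (simp_all add: algebra_simps)
      ultimately show ?thesis using 1 unfolding abs_le_iff by (intro conjI; linarith)
    qed
    moreover have "(\<lambda>n. \<bar>approx f T n a b t x - approx f T n a b s x - (t - s) * G\<bar>)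
        \<longlonglongrightarrow> \<bar>sol f T a b t x - sol f T a b s x - (t - s) * G\<bar>"
      by (intro tendsto_rabs tendsto_diff tendsto_const approx_sol s st x)
    moreover have "(\<lambda>n. (2 * e) * (t - s) + step n * (2 * e + \<bar>G\<bar>)) \<longlonglongrightarrow> (2 * e) * (t - s) + 0 * (2 * e + \<bar>G\<bar>)"
      by (intro tendsto_mult tendsto_add tendsto_const step_tendsto_0)
    ultimately have "\<bar>sol f T a b t x - sol f T a b s x - (t - s) * G\<bar> \<le> (2 * e) * (t - s) + 0 * (2 * e + \<bar>G\<bar>)"
      by (intro LIMSEQ_le) blast+
    then show ?thesis by simp
  qed
  show "\<exists>d>0. \<forall>t\<in>{0..T}. norm (t - t0) < d \<longrightarrow>
      norm (sol f T a b t x - sol f T a b t0 x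
        - (f x - speed (sol f T a b t0) (sol f T b a t0) x * solx f T a b t0 x) * (t - t0)) \<le> e0 * norm (t - t0)"
  proof (intro exI[of _ "\<theta> / 2"] conjI ballI impI)
    fix t assume t: "t \<in> {0..T}" "norm (t - t0) < \<theta> / 2"
    show "norm (sol f T a b t x - sol f T a b t0 x
        - (f x - speed (sol f T a b t0) (sol f T b a t0) x * solx f T a b t0 x) * (t - t0)) \<le> e0 * norm (t - t0)"
      unfolding G_def[symmetric]
    proof (cases "t0 \<le> t")
      case True
      then show "norm (sol f T a b t x - sol f T a b t0 x - G * (t - t0)) \<le> e0 * norm (t - t0)"
        using main[of t0 t] t t0 \<theta> by (simp add: e_def mult.commute)
    next
      case False
      then have "\<bar>sol f T a b t0 x - sol f T a b t x - (t0 - t) * G\<bar> \<le> e0 * (t0 - t)"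
        using main[of t t0] t t0 \<theta> by (simp add: e_def)
      moreover have "sol f T a b t x - sol f T a b t0 x - G * (t - t0)
          = - (sol f T a b t0 x - sol f T a b t x - (t0 - t) * G)" by (simp add: algebra_simps)
      ultimately show "norm (sol f T a b t x - sol f T a b t0 x - G * (t - t0)) \<le> e0 * norm (t - t0)"
        using False by simp
    qed
  qed (use \<theta> in simp)
qed

end

section \<open>Maximum principle and uniqueness\<close>

text \<open>If some \<open>w i\<close> is positive, the weighted function \<open>G\<close> has a
  positive maximum over indices, times up to \<open>t\<close> and the half-line: \<open>init\<close>
  makes it small for small times, and together with the weight \<open>1 / (1 + x)\<close> for large
  \<open>x\<close>. At the maximum \<open>wt \<ge> L * w\<close> and \<open>wx \<le> w\<close>;
  since the speed lies between \<open>- \<Lambda>\<close> and 0, the transport expression is at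
  least \<open>(L - \<Lambda>) * w\<close>, which contradicts \<open>key\<close>. Having
  \<open>key\<close> only at the dominant index admits coupled systems.\<close>

lemma max_principle:
  fixes w wt wx lam :: "'i \<Rightarrow> real \<Rightarrow> real \<Rightarrow> real"
  assumes fin: "finite I"
    and dt: "\<And>i t x. \<lbrakk>i \<in> I; 0 < t; t < T; 0 \<le> x\<rbrakk> \<Longrightarrow> ((\<lambda>s. w i s x) has_real_derivative wt i t x) (at t)"
    and dx: "\<And>i t x. \<lbrakk>i \<in> I; 0 < t; t < T; 0 \<le> x\<rbrakk> \<Longrightarrow> (w i t has_real_derivative wx i t x) (at x within {0..})"
    and cont: "\<And>i. i \<in> I \<Longrightarrow> continuous_on (Omega T) (\<lambda>(t, x). w i t x)"
    and init: "\<And>i t x. \<lbrakk>i \<in> I; 0 < t; t < T; 0 \<le> x\<rbrakk> \<Longrightarrow> w i t x \<le> M * t"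
    and lam0: "\<And>i t x. \<lbrakk>i \<in> I; 0 < t; t < T; 0 \<le> x\<rbrakk> \<Longrightarrow> lam i t x \<le> 0"
    and lam1: "\<And>i t x. \<lbrakk>i \<in> I; 0 < t; t < T; 0 \<le> x\<rbrakk> \<Longrightarrow> - \<Lambda> \<le> lam i t x"
    and key: "\<And>i t x. \<lbrakk>i \<in> I; 0 < t; t < T; 0 \<le> x; 0 < w i t x; \<And>j. j \<in> I \<Longrightarrow> w j t x \<le> w i t x\<rbrakk>
        \<Longrightarrow> wt i t x + lam i t x * wx i t x \<le> K * w i t x"
    and i: "i \<in> I" and t: "0 < t" "t < T" and x: "0 \<le> x"
  shows "w i t x \<le> 0"
proof (rule ccontr)
  assume "\<not> w i t x \<le> 0"
  then have pos: "0 < w i t x" by simp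
  \<comment> \<open>The final contradiction consumes exactly
    \<open>K + \<Lambda> < L\<close>.\<close>
  define L where "L = \<bar>K\<bar> + \<bar>\<Lambda>\<bar> + 1"
  have L: "L > 0" "L > K + \<Lambda>" by (auto simp: L_def)
  define G where "G i t x = w i t x * (exp (- L * t) / (1 + x))" for i t x
  define \<rho> where "\<rho> = G i t x"
  have \<rho>: "\<rho> > 0" using pos x by (auto simp: \<rho>_def G_def)
  have M: "M > 0" using init[OF i t x] pos t by (smt (verit) mult_nonpos_nonneg)
  \<comment> \<open>For times before \<open>\<theta>\<close> or points beyond \<open>R\<close>,
    \<open>G\<close> stays below its value \<open>\<rho>\<close> at the violating point, so only a
    compact rectangle remains.\<close>
  define \<theta> where "\<theta> = min t (\<rho> / M)"
  define R where "R = max x (M * T / \<rho>)"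
  have \<theta>: "0 < \<theta>" "\<theta> \<le> t" "M * \<theta> \<le> \<rho>" using t \<rho> M by (auto simp: \<theta>_def min_def field_simps)
  have R: "x \<le> R" "0 \<le> R" "M * T \<le> \<rho> * R" using x \<rho> M t by (auto simp: R_def max_def field_simps)
  have small: "G j s y < \<rho>" if "j \<in> I" "0 < s" "s \<le> t" "0 \<le> y" "s < \<theta> \<or> R < y" for j s y
  proof -
    have w: "w j s y \<le> M * s" using init that t by simp
    have e: "exp (- L * s) \<le> 1" using L that by simp
    have "G j s y \<le> M * s * (exp (- L * s) / (1 + y))"
      unfolding G_def using w that by (intro mult_right_mono) auto
    also have "\<dots> \<le> M * s * (1 / (1 + y))"
      using M that e by (intro mult_left_mono divide_right_mono) auto
    finally have g: "G j s y \<le> M * s / (1 + y)" by simp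
    have "M * s < \<rho> * (1 + y)"
    proof (cases "s < \<theta>")
      case True
      then have "M * s < M * \<theta>" using M by simp
      also have "\<dots> \<le> \<rho>" by (rule \<theta>)
      also have "\<dots> \<le> \<rho> * (1 + y)" using \<rho> that by simp
      finally show ?thesis .
    next
      case False
      then have "R < y" using that by simp
      have "M * s \<le> M * T" using M that t by simp
      also have "\<dots> \<le> \<rho> * R" by (rule R)
      also have "\<dots> < \<rho> * (1 + y)" using \<rho> \<open>R < y\<close> by simp
      finally show ?thesis .
    qed
    then have "M * s / (1 + y) < \<rho>" using that by (simp add: field_simps)
    then show ?thesis using g by simp
  qed
  define Q where "Q = {\<theta>..t} \<times> {0..R}"
  have Q: "compact Q" "(t, x) \<in> Q" "Q \<subseteq> Omega T"
    using \<theta> R x t by (auto simp: Q_def Omega_def intro: compact_Times)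
  have "\<exists>q\<in>Q. \<forall>p\<in>Q. (\<lambda>(t, x). G j t x) p \<le> (\<lambda>(t, x). G j t x) q" if "j \<in> I" for j
  proof (rule continuous_attains_sup)
    have "continuous_on Q (\<lambda>p. (\<lambda>(t, x). w j t x) p * (exp (- L * fst p) / (1 + snd p)))"
      using R by (intro continuous_intros continuous_on_subset[OF cont[OF that] Q(3)]) (auto simp: Q_def)
    then show "continuous_on Q (\<lambda>(t, x). G j t x)"
      by (simp add: G_def case_prod_unfold)
  qed (use Q in auto)
  then obtain q where q: "\<And>j. j \<in> I \<Longrightarrow> q j \<in> Q"
    "\<And>j p. j \<in> I \<Longrightarrow> p \<in> Q \<Longrightarrow> (\<lambda>(t, x). G j t x) p \<le> (\<lambda>(t, x). G j t x) (q j)"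
    by metis
  define m where "m j = (\<lambda>(t, x). G j t x) (q j)" for j
  \<comment> \<open>The weight is the same for all indices, so the index where \<open>G\<close> is
    largest also has the largest \<open>w\<close> at that point.\<close>
  have "Max (m ` I) \<in> m ` I" using fin i by (intro Max_in) auto
  then obtain k where k: "k \<in> I" "m k = Max (m ` I)" by auto
  obtain t1 x1 where q1: "q k = (t1, x1)" by fastforce
  then have t1: "0 < t1" "t1 \<le> t" "t1 < T" and x1: "0 \<le> x1"
    using q(1)[OF k(1)] \<theta> t by (auto simp: Q_def)
  have mx: "G j s y \<le> G k t1 x1" if "j \<in> I" "(s, y) \<in> Q" for j s y
  proof -
    have "G j s y \<le> m j" using q(2)[OF that] by (simp add: m_def)
    also have "\<dots> \<le> m k" using fin that k by simp
    finally show ?thesis by (simp add: m_def q1)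
  qed
  have \<rho>1: "\<rho> \<le> G k t1 x1" using mx[OF i Q(2)] by (simp add: \<rho>_def)
  have mx': "G j s y \<le> G k t1 x1" if "j \<in> I" "0 < s" "s \<le> t" "0 \<le> y" for j s y
  proof (cases "s < \<theta> \<or> R < y")
    case True
    then show ?thesis using small[OF that] \<rho>1 by simp
  next
    case False
    then show ?thesis using that by (intro mx) (auto simp: Q_def)
  qed
  have "0 < G k t1 x1" using \<rho> \<rho>1 by simp
  then have wpos: "0 < w k t1 x1"
    using x1 by (simp add: G_def zero_less_mult_iff zero_less_divide_iff)
  have wmax: "w j t1 x1 \<le> w k t1 x1" if "j \<in> I" for j
  proof -
    have "0 < exp (- L * t1) / (1 + x1)" using x1 by simp
    then show ?thesis using mx'[OF that t1(1,2) x1] unfolding G_def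
      by (rule mult_right_le_imp_le[rotated])
  qed
  have E: "0 < exp (- L * t1) / (1 + x1)" using x1 by simp
  have "((\<lambda>s. exp (- L * s) / (1 + x1)) has_real_derivative - L * exp (- L * t1) / (1 + x1)) (at t1)"
    by (rule DERIV_cdivide) (auto intro!: derivative_eq_intros)
  from DERIV_mult[OF dt[OF k(1) t1(1,3) x1] this]
  have "((\<lambda>s. G k s x1) has_real_derivative
      (wt k t1 x1 - L * w k t1 x1) * (exp (- L * t1) / (1 + x1))) (at t1)"
    unfolding G_def by (simp add: algebra_simps diff_divide_distrib)
  \<comment> \<open>The maximum may sit at the final time \<open>t\<close>, so it is compared with
    earlier times only.\<close>
  then have "0 \<le> (wt k t1 x1 - L * w k t1 x1) * (exp (- L * t1) / (1 + x1))"
  proof (rule_tac ccontr)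
    assume "((\<lambda>s. G k s x1) has_real_derivative
      (wt k t1 x1 - L * w k t1 x1) * (exp (- L * t1) / (1 + x1))) (at t1)"
      "\<not> 0 \<le> (wt k t1 x1 - L * w k t1 x1) * (exp (- L * t1) / (1 + x1))"
    then obtain d where d: "d > 0" "\<And>h. 0 < h \<Longrightarrow> h < d \<Longrightarrow> G k t1 x1 < G k (t1 - h) x1"
      using DERIV_neg_dec_left[of "\<lambda>s. G k s x1"] by (metis not_le)
    define h where "h = min (d/2) (t1/2)"
    have "0 < h" "h < d" "h < t1" using d t1 by (auto simp: h_def)
    then show False using d(2)[of h] mx'[OF k(1), of "t1 - h" x1] t1 x1 by simp
  qed
  then have 1: "L * w k t1 x1 \<le> wt k t1 x1" using E by (simp only: zero_le_mult_iff) linarith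
  have "((\<lambda>y. exp (- L * t1) / (1 + y)) has_real_derivative - (exp (- L * t1) / (1 + x1)) / (1 + x1))
      (at x1 within {0..})"
    using x1 by (auto intro!: derivative_eq_intros)
  from DERIV_mult[OF dx[OF k(1) t1(1,3) x1] this]
  have "((\<lambda>y. G k t1 y) has_real_derivative
      (wx k t1 x1 - w k t1 x1 / (1 + x1)) * (exp (- L * t1) / (1 + x1))) (at x1 within {0..})"
    unfolding G_def by (simp add: algebra_simps diff_divide_distrib)
  \<comment> \<open>The maximum may sit at the boundary \<open>x1 = 0\<close>, so it is compared
    with points to the right only. The resulting one-sided bound on \<open>wx\<close> fits the sign
    of the speed, and no boundary condition enters.\<close>
  then have "(wx k t1 x1 - w k t1 x1 / (1 + x1)) * (exp (- L * t1) / (1 + x1)) \<le> 0"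
  proof (rule_tac ccontr)
    assume "((\<lambda>y. G k t1 y) has_real_derivative
      (wx k t1 x1 - w k t1 x1 / (1 + x1)) * (exp (- L * t1) / (1 + x1))) (at x1 within {0..})"
      "\<not> (wx k t1 x1 - w k t1 x1 / (1 + x1)) * (exp (- L * t1) / (1 + x1)) \<le> 0"
    then obtain d where d: "d > 0"
      "\<And>h. 0 < h \<Longrightarrow> x1 + h \<in> {0..} \<Longrightarrow> h < d \<Longrightarrow> G k t1 x1 < G k t1 (x1 + h)"
      using has_real_derivative_pos_inc_right[of "G k t1"] by (metis not_le)
    have "G k t1 x1 < G k t1 (x1 + d/2)" using d(1) x1 by (intro d(2)) auto
    then show False using d(1) mx'[OF k(1), of "t1" "x1 + d/2"] t1 x1 by simp
  qed
  then have 2: "wx k t1 x1 \<le> w k t1 x1 / (1 + x1)"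
    using E by (simp only: mult_le_0_iff) linarith
  also have "\<dots> \<le> w k t1 x1" using wpos x1 by (simp add: field_simps)
  finally have "lam k t1 x1 * w k t1 x1 \<le> lam k t1 x1 * wx k t1 x1"
    using lam0[OF k(1) t1(1,3) x1] by (simp add: mult_left_mono_neg)
  moreover have "- \<Lambda> * w k t1 x1 \<le> lam k t1 x1 * w k t1 x1"
    using lam1[OF k(1) t1(1,3) x1] wpos by (intro mult_right_mono) auto
  moreover have "K * w k t1 x1 < (L - \<Lambda>) * w k t1 x1" using L wpos by simp
  ultimately show False using key[OF k(1) t1(1,3) x1 wpos wmax] 1 by (simp add: algebra_simps)
qed

section \<open>Working with the solution class\<close>

lemma C11I:
  assumes "\<And>t x. \<lbrakk>0 < t; t < T; 0 \<le> x\<rbrakk> \<Longrightarrow> ((\<lambda>s. v s x) has_real_derivative vt t x) (at t)"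
    and "\<And>t x. \<lbrakk>0 < t; t < T; 0 \<le> x\<rbrakk> \<Longrightarrow> (v t has_real_derivative vx t x) (at x within {0..})"
    and "continuous_on (Omega T) (\<lambda>(t, x). vt t x)" "continuous_on (Omega T) (\<lambda>(t, x). vx t x)"
    and "\<And>t x. \<lbrakk>0 < t; t < T; 0 \<le> x\<rbrakk> \<Longrightarrow> \<bar>v t x\<bar> \<le> K"
    and "\<And>t x. \<lbrakk>0 < t; t < T; 0 \<le> x\<rbrakk> \<Longrightarrow> \<bar>vt t x\<bar> \<le> K"
    and "\<And>t x. \<lbrakk>0 < t; t < T; 0 \<le> x\<rbrakk> \<Longrightarrow> \<bar>vx t x\<bar> \<le> K"
  shows "v \<in> C11 T"
    and "\<And>t x. \<lbrakk>0 < t; t < T; 0 \<le> x\<rbrakk> \<Longrightarrow> dt v t x = vt t x"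
    and "\<And>t x. \<lbrakk>0 < t; t < T; 0 \<le> x\<rbrakk> \<Longrightarrow> dx v t x = vx t x"
proof -
  show dt: "dt v t x = vt t x" if "0 < t" "t < T" "0 \<le> x" for t x
    using assms(1)[OF that] unfolding dt_def by (rule DERIV_imp_deriv)
  show dx: "dx v t x = vx t x" if "0 < t" "t < T" "0 \<le> x" for t x
    using assms(2)[OF that] that(3) unfolding dx_def by (rule hderiv_eqI)
  have "continuous_on (Omega T) (\<lambda>(t, x). dt v t x)"
    by (rule continuous_on_eq[OF assms(3)]) (auto simp: dt Omega_def)
  moreover have "continuous_on (Omega T) (\<lambda>(t, x). dx v t x)"
    by (rule continuous_on_eq[OF assms(4)]) (auto simp: dx Omega_def)
  moreover have "bounded ((\<lambda>(t, x). v t x) ` Omega T)" "bounded ((\<lambda>(t, x). dt v t x) ` Omega T)"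
    "bounded ((\<lambda>(t, x). dx v t x) ` Omega T)"
    unfolding bounded_iff using assms(5-7) dt dx by (auto simp: Omega_def intro!: exI[of _ K])
  moreover have "(\<lambda>s. v s x) field_differentiable (at t) \<and> v t differentiable (at x within {0..})"
    if "(t, x) \<in> Omega T" for t x
    using assms(1,2)[of t x] that by (auto simp: Omega_def field_differentiable_def real_differentiable_def)
  ultimately show "v \<in> C11 T" unfolding C11_def by blast
qed

lemma C11D:
  assumes "v \<in> C11 T" "0 < t" "t < T" "0 \<le> x"
  shows "((\<lambda>s. v s x) has_real_derivative dt v t x) (at t)"
    "(v t has_real_derivative dx v t x) (at x within {0..})"
proof -
  have "(\<lambda>s. v s x) field_differentiable (at t)" "v t differentiable (at x within {0..})"
    using assms by (auto simp: C11_def Omega_def)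
  then show "((\<lambda>s. v s x) has_real_derivative dt v t x) (at t)"
    "(v t has_real_derivative dx v t x) (at x within {0..})"
    unfolding dt_def dx_def using hderiv_works assms(4) by (simp_all add: DERIV_deriv_iff_field_differentiable)
qed

lemma C11_bound:
  assumes "v \<in> C11 T"
  obtains K where "0 \<le> K" "\<And>t x. \<lbrakk>0 < t; t < T; 0 \<le> x\<rbrakk> \<Longrightarrow> \<bar>v t x\<bar> \<le> K \<and> \<bar>dt v t x\<bar> \<le> K \<and> \<bar>dx v t x\<bar> \<le> K"
proof -
  have bd: "\<exists>K. \<forall>t x. 0 < t \<longrightarrow> t < T \<longrightarrow> 0 \<le> x \<longrightarrow> \<bar>k t x\<bar> \<le> K"
    if "bounded ((\<lambda>(t, x). k t x) ` Omega T)" for k :: "real \<Rightarrow> real \<Rightarrow> real"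
    using that by (fastforce simp: bounded_iff Omega_def)
  obtain K1 K2 K3 where "\<forall>t x. 0 < t \<longrightarrow> t < T \<longrightarrow> 0 \<le> x \<longrightarrow> \<bar>v t x\<bar> \<le> K1"
    "\<forall>t x. 0 < t \<longrightarrow> t < T \<longrightarrow> 0 \<le> x \<longrightarrow> \<bar>dt v t x\<bar> \<le> K2" "\<forall>t x. 0 < t \<longrightarrow> t < T \<longrightarrow> 0 \<le> x \<longrightarrow> \<bar>dx v t x\<bar> \<le> K3"
    using bd[of v] bd[of "dt v"] bd[of "dx v"] assms unfolding C11_def by blast
  then show ?thesis by (intro that[of "max 0 (max K1 (max K2 K3))"]) (auto simp: le_max_iff_disj)
qed

lemma C11_time_lipschitz:
  assumes v: "v \<in> C11 T" and K: "\<And>t x. \<lbrakk>0 < t; t < T; 0 \<le> x\<rbrakk> \<Longrightarrow> \<bar>dt v t x\<bar> \<le> K"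
    and "0 < s" "s < T" "0 < t" "t < T" "0 \<le> x"
  shows "\<bar>v t x - v s x\<bar> \<le> K * \<bar>t - s\<bar>"
proof -
  have "norm (v t x - v s x) \<le> K * norm (t - s)"
  proof (rule field_differentiable_bound[of "{0<..<T}"])
    fix z assume "z \<in> {0<..<T}"
    then show "((\<lambda>t. v t x) has_field_derivative dt v z x) (at z within {0<..<T})" "norm (dt v z x) \<le> K"
      using C11D(1)[OF v] K assms(7) by (auto intro: has_field_derivative_at_within)
  qed (use assms in auto)
  then show ?thesis by simp
qed

text \<open>Bounded partial derivatives give a Lipschitz bound in each variable, hence joint
  continuity.\<close>

lemma C11_continuous:
  assumes v: "v \<in> C11 T"
  shows "continuous_on (Omega T) (\<lambda>(t, x). v t x)"
proof -
  obtain K where K: "0 \<le> K" "\<And>t x. \<lbrakk>0 < t; t < T; 0 \<le> x\<rbrakk> \<Longrightarrow> \<bar>v t x\<bar> \<le> K \<and> \<bar>dt v t x\<bar> \<le> K \<and> \<bar>dx v t x\<bar> \<le> K"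
    by (rule C11_bound[OF v]) blast
  show ?thesis
  proof (rule continuous_on_lipschitz_pair)
    fix t x s y assume "(t, x) \<in> Omega T" "(s, y) \<in> Omega T"
    then have *: "0 < t" "t < T" "0 \<le> x" "0 < s" "s < T" "0 \<le> y" by (auto simp: Omega_def)
    have "\<bar>v t x - v s x\<bar> \<le> K * \<bar>t - s\<bar>" using C11_time_lipschitz[OF v, of K s t x] K * by blast
    moreover have "\<bar>v s x - v s y\<bar> \<le> K * \<bar>x - y\<bar>"
      using lipschitz_of_deriv_bound[of "v s" "dx v s" K x y] C11D(2)[OF v] K * by blast
    ultimately show "\<bar>v t x - v s y\<bar> \<le> K * \<bar>t - s\<bar> + K * \<bar>x - y\<bar>" by linarith
  qed (use K in auto)
qed

text \<open>Letting \<open>s\<close> tend to 0 in the Lipschitz bound in time turns the initial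
  condition, stated as a limit, into the linear growth that \<open>max_principle\<close> takes as
  input.\<close>

lemma initial_growth:
  assumes v: "v \<in> C11 T" and init: "initial_value T v v0"
    and K: "\<And>t x. \<lbrakk>0 < t; t < T; 0 \<le> x\<rbrakk> \<Longrightarrow> \<bar>dt v t x\<bar> \<le> K" and "0 \<le> K"
    and t: "0 < t" "t < T" and x: "0 \<le> x"
  shows "\<bar>v t x - v0 x\<bar> \<le> K * t"
proof -
  have near: "\<forall>\<^sub>F s in at_right 0. 0 < s \<and> s < t"
    using eventually_at_right_real[OF t(1)] by simp
  have "((\<lambda>s. (\<lambda>(t, y). v t y) (s, x)) \<longlongrightarrow> v0 x) (at_right 0)"
  proof (rule filterlim_compose[of "\<lambda>(t, y). v t y"])
    show "((\<lambda>(t, y). v t y) \<longlongrightarrow> v0 x) (at (0, x) within Omega T)"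
      using init x by (auto simp: initial_value_def)
    have "((\<lambda>s. (s, x)) \<longlongrightarrow> (0, x)) (at_right 0)" by (intro tendsto_intros)
    moreover have "\<forall>\<^sub>F s in at_right 0. (s, x) \<in> Omega T \<and> (s, x) \<noteq> (0, x)"
      using near by (rule eventually_mono) (use t x in \<open>auto simp: Omega_def\<close>)
    ultimately show "filterlim (\<lambda>s. (s, x)) (at (0, x) within Omega T) (at_right 0)"
      by (simp add: filterlim_at)
  qed
  then have "((\<lambda>s. \<bar>v t x - v s x\<bar>) \<longlongrightarrow> \<bar>v t x - v0 x\<bar>) (at_right 0)"
    by (intro tendsto_rabs tendsto_diff tendsto_const) simp
  moreover have "\<forall>\<^sub>F s in at_right 0. \<bar>v t x - v s x\<bar> \<le> K * t"
    using near
  proof (rule eventually_mono)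
    fix s assume s: "0 < s \<and> s < t"
    then have "\<bar>v t x - v s x\<bar> \<le> K * \<bar>t - s\<bar>" using t x by (intro C11_time_lipschitz[OF v K]) auto
    also have "\<dots> \<le> K * t" using s \<open>0 \<le> K\<close> by (intro mult_left_mono) auto
    finally show "\<bar>v t x - v s x\<bar> \<le> K * t" .
  qed
  ultimately show ?thesis by (rule tendsto_upperbound) simp
qed

lemma shallow_water_solutionD:
  assumes "shallow_water_solution h u0 \<eta>0 T u \<eta>"
    and h: "\<And>x. 0 \<le> x \<Longrightarrow> (h has_real_derivative h' x) (at x within {0..})"
    and t: "0 < t" "t < T" and x: "0 \<le> x"
  shows "dt u t x = - (u t x * dx u t x + dx \<eta> t x)"
    "dt \<eta> t x = - (dx u t x * (h x + \<eta> t x) + u t x * (h' x + dx \<eta> t x))"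
proof -
  have uC: "u \<in> C11 T" and eC: "\<eta> \<in> C11 T"
    and eqs: "\<forall>(t, x)\<in>Omega T. dt \<eta> t x + dx (\<lambda>s y. u s y * (h y + \<eta> s y)) t x = 0 \<and>
        dt u t x + u t x * dx u t x + dx \<eta> t x = 0"
    using assms(1) unfolding shallow_water_solution_def by auto
  have "((\<lambda>y. u t y * (h y + \<eta> t y)) has_real_derivative
      dx u t x * (h x + \<eta> t x) + u t x * (h' x + dx \<eta> t x)) (at x within {0..})"
    using C11D(2)[OF uC t x] C11D(2)[OF eC t x] h[OF x]
    by (auto intro!: derivative_eq_intros)
  then have "dx (\<lambda>s y. u s y * (h y + \<eta> s y)) t x = dx u t x * (h x + \<eta> t x) + u t x * (h' x + dx \<eta> t x)"
    unfolding dx_def using x by (intro hderiv_eqI)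
  moreover have "dt \<eta> t x + dx (\<lambda>s y. u s y * (h y + \<eta> s y)) t x = 0 \<and> dt u t x + u t x * dx u t x + dx \<eta> t x = 0"
    using eqs t x by (auto simp: Omega_def)
  ultimately show "dt \<eta> t x = - (dx u t x * (h x + \<eta> t x) + u t x * (h' x + dx \<eta> t x))"
    "dt u t x = - (u t x * dx u t x + dx \<eta> t x)"
    by linarith+
qed

text \<open>The differences \<open>v = u' - u\<close> and \<open>g = \<eta>' - \<eta>\<close> satisfy a linear hyperbolic system whose principal part
  only involves the known solution, so the other solution needs no positivity of its depth. Its
  characteristic variables, multiplied by \<open>c\<close> to avoid quotients, are \<open>c v \<plusminus> g\<close>.\<close>

lemma shallow_water_unique:
  assumes sol: "shallow_water_solution h u0 \<eta>0 T u \<eta>" and sol': "shallow_water_solution h u0 \<eta>0 T u' \<eta>'"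
    and h: "\<And>x. 0 \<le> x \<Longrightarrow> (h has_real_derivative h' x) (at x within {0..})"
    and h': "\<And>x. 0 \<le> x \<Longrightarrow> \<bar>h' x\<bar> \<le> B"
    and c: "c \<in> C11 T"
    and cH: "\<And>t x. \<lbrakk>0 < t; t < T; 0 \<le> x\<rbrakk> \<Longrightarrow> h x + \<eta> t x = (c t x)\<^sup>2"
    and c0: "0 < c0" "\<And>t x. \<lbrakk>0 < t; t < T; 0 \<le> x\<rbrakk> \<Longrightarrow> c0 \<le> c t x"
    and outgoing: "\<And>t x. \<lbrakk>0 < t; t < T; 0 \<le> x\<rbrakk> \<Longrightarrow> u t x + c t x \<le> 0"
    and tx: "0 < t" "t < T" "0 \<le> x"
  shows "u' t x = u t x \<and> \<eta>' t x = \<eta> t x"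
proof -
  have C: "u \<in> C11 T" "\<eta> \<in> C11 T" "u' \<in> C11 T" "\<eta>' \<in> C11 T"
    and init: "initial_value T u u0" "initial_value T \<eta> \<eta>0" "initial_value T u' u0" "initial_value T \<eta>' \<eta>0"
    using sol sol' by (auto simp: shallow_water_solution_def)
  obtain K1 where K1: "0 \<le> K1" "\<And>t x. \<lbrakk>0 < t; t < T; 0 \<le> x\<rbrakk> \<Longrightarrow> \<bar>u t x\<bar> \<le> K1 \<and> \<bar>dt u t x\<bar> \<le> K1 \<and> \<bar>dx u t x\<bar> \<le> K1"
    by (rule C11_bound[OF C(1)]) blast
  obtain K2 where K2: "0 \<le> K2" "\<And>t x. \<lbrakk>0 < t; t < T; 0 \<le> x\<rbrakk> \<Longrightarrow> \<bar>\<eta> t x\<bar> \<le> K2 \<and> \<bar>dt \<eta> t x\<bar> \<le> K2 \<and> \<bar>dx \<eta> t x\<bar> \<le> K2"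
    by (rule C11_bound[OF C(2)]) blast
  obtain K3 where K3: "0 \<le> K3" "\<And>t x. \<lbrakk>0 < t; t < T; 0 \<le> x\<rbrakk> \<Longrightarrow> \<bar>u' t x\<bar> \<le> K3 \<and> \<bar>dt u' t x\<bar> \<le> K3 \<and> \<bar>dx u' t x\<bar> \<le> K3"
    by (rule C11_bound[OF C(3)]) blast
  obtain K4 where K4: "0 \<le> K4" "\<And>t x. \<lbrakk>0 < t; t < T; 0 \<le> x\<rbrakk> \<Longrightarrow> \<bar>\<eta>' t x\<bar> \<le> K4 \<and> \<bar>dt \<eta>' t x\<bar> \<le> K4 \<and> \<bar>dx \<eta>' t x\<bar> \<le> K4"
    by (rule C11_bound[OF C(4)]) blast
  obtain K5 where K5: "0 \<le> K5" "\<And>t x. \<lbrakk>0 < t; t < T; 0 \<le> x\<rbrakk> \<Longrightarrow> \<bar>c t x\<bar> \<le> K5 \<and> \<bar>dt c t x\<bar> \<le> K5 \<and> \<bar>dx c t x\<bar> \<le> K5"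
    by (rule C11_bound[OF c]) blast
  define L where "L = K1 + K5"
  define P where "P = K5 + L * K5 + K5 * K3 + (B + K4)"
  have "0 \<le> B" using h'[of 0] by simp
  then have L0: "0 \<le> L" and P0: "0 \<le> P" using K1 K2 K3 K4 K5 by (auto simp: L_def P_def)
  define v where "v t x = u' t x - u t x" for t x
  define g where "g t x = \<eta>' t x - \<eta> t x" for t x
  \<comment> \<open>\<open>snd i\<close> selects the characteristic family and \<open>fst i\<close>
    the sign, so that upper bounds for the four functions control absolute values.\<close>
  define w where "w i t x = fst i * (c t x * v t x + snd i * g t x)" for i :: "real \<times> real" and t x
  define wt where "wt i t x = fst i * (dt c t x * v t x + c t x * (dt u' t x - dt u t x) + snd i * (dt \<eta>' t x - dt \<eta> t x))"
    for i :: "real \<times> real" and t x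
  define wx where "wx i t x = fst i * (dx c t x * v t x + c t x * (dx u' t x - dx u t x) + snd i * (dx \<eta>' t x - dx \<eta> t x))"
    for i :: "real \<times> real" and t x
  define lam where "lam i t x = u t x + snd i * c t x" for i :: "real \<times> real" and t x
  define I where "I = {1, -1 :: real} \<times> {1, -1 :: real}"
  have I: "\<bar>fst i\<bar> = 1" "\<bar>snd i\<bar> = 1" "snd i * snd i = 1" if "i \<in> I" for i
    using that by (auto simp: I_def)
  have cpos: "0 < c t x" if "0 < t" "t < T" "0 \<le> x" for t x
    using c0(1) c0(2)[OF that] by linarith
  have w0: "w i t x \<le> 0" if "i \<in> I" for i
  proof (rule max_principle[of I T w wt wx "K5 * (K3 + K1) + (K4 + K2)" lam L "P / c0 + K3"])
    show "finite I" by (simp add: I_def)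
    show "i \<in> I" by fact
  next
    fix i t x assume i: "i \<in> I" and tx: "0 < t" "t < (T::real)" "0 \<le> (x::real)"
    note D = C11D[OF C(1) tx] C11D[OF C(2) tx] C11D[OF C(3) tx] C11D[OF C(4) tx] C11D[OF c tx]
    show "((\<lambda>s. w i s x) has_real_derivative wt i t x) (at t)"
      unfolding w_def wt_def v_def g_def using D by (auto intro!: derivative_eq_intros simp: algebra_simps)
    show "(w i t has_real_derivative wx i t x) (at x within {0..})"
      unfolding w_def wx_def v_def g_def using D by (auto intro!: derivative_eq_intros simp: algebra_simps)
    have "\<bar>u' t x - u0 x\<bar> \<le> K3 * t" "\<bar>u t x - u0 x\<bar> \<le> K1 * t" "\<bar>\<eta>' t x - \<eta>0 x\<bar> \<le> K4 * t" "\<bar>\<eta> t x - \<eta>0 x\<bar> \<le> K2 * t"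
      using initial_growth[OF C(3) init(3) _ K3(1) tx] initial_growth[OF C(1) init(1) _ K1(1) tx]
        initial_growth[OF C(4) init(4) _ K4(1) tx] initial_growth[OF C(2) init(2) _ K2(1) tx] K1 K2 K3 K4 by blast+
    then have vg: "\<bar>v t x\<bar> \<le> (K3 + K1) * t" "\<bar>g t x\<bar> \<le> (K4 + K2) * t"
      unfolding v_def g_def by (simp_all add: algebra_simps)
    have "\<bar>c t x * v t x\<bar> \<le> K5 * ((K3 + K1) * t)"
      unfolding abs_mult using K5(2)[OF tx] vg K5(1) by (intro mult_mono) auto
    moreover have "w i t x \<le> \<bar>c t x * v t x\<bar> + \<bar>g t x\<bar>"
      using i by (auto simp: I_def w_def)
    ultimately show "w i t x \<le> (K5 * (K3 + K1) + (K4 + K2)) * t" using vg by (simp add: algebra_simps)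
    show "lam i t x \<le> 0"
      using i outgoing[OF tx] cpos[OF tx] by (auto simp: I_def lam_def)
    show lamL: "- L \<le> lam i t x"
      using i K1(2)[OF tx] K5(2)[OF tx] by (auto simp: I_def lam_def L_def)
    assume pos: "0 < w i t x" and mx: "\<And>j. j \<in> I \<Longrightarrow> w j t x \<le> w i t x"
    \<comment> \<open>The largest of the four sign combinations equals the sum of the absolute
      values.\<close>
    have sum: "\<bar>c t x * v t x\<bar> + \<bar>g t x\<bar> \<le> w i t x"
      using mx[of "(1, 1)"] mx[of "(1, -1)"] mx[of "(-1, 1)"] mx[of "(-1, -1)"]
      by (simp add: I_def w_def)
    have "c0 * \<bar>v t x\<bar> \<le> \<bar>c t x * v t x\<bar>"
      unfolding abs_mult using c0(2)[OF tx] cpos[OF tx] by (intro mult_right_mono) auto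
    then have vw: "\<bar>v t x\<bar> \<le> w i t x / c0" using sum c0(1) by (simp add: field_simps)
    have gw: "\<bar>g t x\<bar> \<le> w i t x" using sum by linarith
    define p where "p = dt c t x + lam i t x * dx c t x - c t x * dx u' t x - snd i * (h' x + dx \<eta>' t x)"
    \<comment> \<open>The x-derivatives of \<open>v\<close> and \<open>g\<close> cancel because
      \<open>snd i\<close> squares to 1. What remains is linear in \<open>v\<close> and
      \<open>g\<close>, with bounded coefficients built from \<open>c\<close>, \<open>h'\<close> and
      the x-derivatives of the other solution.\<close>
    have "wt i t x + lam i t x * wx i t x = fst i * (v t x * p - snd i * (dx u' t x * g t x))"
    proof -
      have E: "dt u t x = - (u t x * dx u t x + dx \<eta> t x)"
        "dt \<eta> t x = - (dx u t x * (h x + \<eta> t x) + u t x * (h' x + dx \<eta> t x))"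
        "dt u' t x = - (u' t x * dx u' t x + dx \<eta>' t x)"
        "dt \<eta>' t x = - (dx u' t x * (h x + \<eta>' t x) + u' t x * (h' x + dx \<eta>' t x))"
        using shallow_water_solutionD[OF sol _ tx, of h'] shallow_water_solutionD[OF sol' _ tx, of h'] h by blast+
      have et: "h x + \<eta>' t x = (c t x)\<^sup>2 + g t x" using cH[OF tx] by (simp add: g_def)
      have ss: "snd i * (snd i * z) = z" for z using I(3)[OF i] by (simp flip: mult.assoc)
      show ?thesis
        unfolding wt_def wx_def p_def lam_def unfolding E unfolding et cH[OF tx]
        by (simp add: v_def g_def algebra_simps power2_eq_square ss)
    qed
    also have "\<dots> \<le> \<bar>fst i * (v t x * p - snd i * (dx u' t x * g t x))\<bar>" by simp
    also have "\<dots> = \<bar>v t x * p - snd i * (dx u' t x * g t x)\<bar>" by (simp add: abs_mult I(1)[OF i])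
    also have "\<dots> \<le> \<bar>v t x * p\<bar> + \<bar>snd i * (dx u' t x * g t x)\<bar>" by (rule abs_triangle_ineq4)
    also have "\<dots> = \<bar>v t x\<bar> * \<bar>p\<bar> + \<bar>dx u' t x\<bar> * \<bar>g t x\<bar>" by (simp add: abs_mult I(2)[OF i])
    also have "\<dots> \<le> (w i t x / c0) * P + K3 * w i t x"
    proof (intro add_mono mult_mono vw gw)
      have "\<bar>lam i t x\<bar> \<le> L" using lamL \<open>lam i t x \<le> 0\<close> by linarith
      then have "\<bar>lam i t x * dx c t x\<bar> \<le> L * K5"
        unfolding abs_mult using K5(2)[OF tx] L0 by (intro mult_mono) auto
      moreover have "\<bar>c t x * dx u' t x\<bar> \<le> K5 * K3"
        unfolding abs_mult using K5 K3 tx by (intro mult_mono) auto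
      moreover have "\<bar>snd i * (h' x + dx \<eta>' t x)\<bar> \<le> B + K4"
        unfolding abs_mult I(2)[OF i] mult_1_left using h'[OF tx(3)] K4(2)[OF tx] by linarith
      moreover have "\<bar>dt c t x\<bar> \<le> K5" using K5(2)[OF tx] by simp
      ultimately show "\<bar>p\<bar> \<le> P" unfolding p_def P_def by linarith
    qed (use K3 tx pos c0 in auto)
    also have "\<dots> = (P / c0 + K3) * w i t x" by (simp add: algebra_simps)
    finally show "wt i t x + lam i t x * wx i t x \<le> (P / c0 + K3) * w i t x" .
  next
    fix i assume "i \<in> I"
    show "continuous_on (Omega T) (\<lambda>(t, x). w i t x)"
      using C11_continuous[OF C(1)] C11_continuous[OF C(2)] C11_continuous[OF C(3)] C11_continuous[OF C(4)]
        C11_continuous[OF c]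
      unfolding w_def v_def g_def case_prod_unfold by (intro continuous_intros)
  qed (use tx in auto)
  have "\<bar>c t x * v t x\<bar> + \<bar>g t x\<bar> \<le> 0"
    using w0[of "(1, 1)"] w0[of "(1, -1)"] w0[of "(-1, 1)"] w0[of "(-1, -1)"]
    by (simp add: I_def w_def)
  then have "c t x * v t x = 0" "g t x = 0" by linarith+
  then show ?thesis using cpos[OF tx] by (simp add: v_def g_def)
qed

section \<open>Existence and the main result\<close>

lemma Cb_bound:
  assumes f: "f \<in> Cb n" and j: "j \<le> n" and x: "0 \<le> x"
  shows "\<bar>(hderiv ^^ j) f x\<bar> \<le> Cb_norm n f"
proof -
  define s where "s i = (SUP x\<in>{0..}. \<bar>(hderiv ^^ i) f x\<bar>)" for i
  have s: "\<bar>(hderiv ^^ i) f y\<bar> \<le> s i" if "i \<le> n" "0 \<le> y" for i y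
  proof -
    have "bounded ((hderiv ^^ i) f ` {0..})" using f that(1) by (auto simp: Cb_def)
    then have "bdd_above ((\<lambda>x. \<bar>(hderiv ^^ i) f x\<bar>) ` {0..})" by (auto simp: bounded_iff bdd_above_def)
    then show ?thesis unfolding s_def using that(2) by (intro cSUP_upper) auto
  qed
  have s0: "0 \<le> s i" if "i \<le> n" for i using s[OF that, of 0] by simp
  have norm: "Cb_norm n f = (\<Sum>i=0..n. s i)"
    unfolding Cb_norm_def s_def by (simp add: sum.atLeast_Suc_atMost)
  have "s j \<le> (\<Sum>i=0..n. s i)" using j s0 by (intro member_le_sum) auto
  then show ?thesis using s[OF j x] norm by simp
qed

lemma Cb_1_iff:
  "f \<in> Cb 1 \<longleftrightarrow> (\<forall>x\<ge>0. f differentiable (at x within {0..})) \<and> continuous_on {0..} f \<and> bounded (f ` {0..})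
    \<and> continuous_on {0..} (hderiv f) \<and> bounded (hderiv f ` {0..})"
  by (auto simp: Cb_def le_Suc_eq)

lemma Cb_1I:
  assumes "\<And>x. 0 \<le> x \<Longrightarrow> (f has_real_derivative f' x) (at x within {0..})" "continuous_on {0..} f'"
    and "\<And>x. 0 \<le> x \<Longrightarrow> \<bar>f x\<bar> \<le> K" "\<And>x. 0 \<le> x \<Longrightarrow> \<bar>f' x\<bar> \<le> K"
  shows "f \<in> Cb 1"
proof -
  have D: "hderiv f x = f' x" if "0 \<le> x" for x using hderiv_eqI assms(1) that by blast
  have "f differentiable (at x within {0..})" if "0 \<le> x" for x
    using assms(1)[OF that] by (auto simp: real_differentiable_def)
  moreover have "continuous_on {0..} f" using assms(1) by (intro DERIV_continuous_on) auto
  moreover have "continuous_on {0..} (hderiv f)" by (rule continuous_on_eq[OF assms(2)]) (simp add: D)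
  moreover have "bounded (f ` {0..})" "bounded (hderiv f ` {0..})"
    unfolding bounded_iff using assms(3,4) D by (auto intro!: exI[of _ K])
  ultimately show ?thesis unfolding Cb_1_iff by blast
qed

text \<open>The lower bound \<open>C\<close> on the depth keeps the derivative of the square root
  bounded. Membership in \<open>Cb 1\<close> is what gives meaning to the norms defining
  \<open>C\<phi>\<close>.\<close>

lemma riemann_invariant_Cb_1:
  assumes u: "u \<in> Cb 1"
    and k: "\<And>x. 0 \<le> x \<Longrightarrow> (k has_real_derivative k' x) (at x within {0..})" "continuous_on {0..} k'"
    and C: "0 < C" "\<And>x. 0 \<le> x \<Longrightarrow> C \<le> k x" and K: "\<And>x. 0 \<le> x \<Longrightarrow> k x \<le> K" "\<And>x. 0 \<le> x \<Longrightarrow> \<bar>k' x\<bar> \<le> K"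
  shows "(\<lambda>x. u x + s * sqrt (k x)) \<in> Cb 1"
proof (rule Cb_1I)
  have kpos: "0 < k x" if "0 \<le> x" for x using C(1) C(2)[OF that] by linarith
  have ud: "\<forall>x\<ge>0. u differentiable (at x within {0..})" and uc: "continuous_on {0..} (hderiv u)"
    using u unfolding Cb_1_iff by auto
  show "((\<lambda>x. u x + s * sqrt (k x)) has_real_derivative hderiv u x + s * (inverse (sqrt (k x)) / 2 * k' x))
      (at x within {0..})" if x: "0 \<le> x" for x
    using DERIV_chain'[OF k(1)[OF x] DERIV_real_sqrt[OF kpos[OF x]]] hderiv_works[OF _ x, of u] ud x
    by (intro DERIV_add DERIV_cmult) auto
  have kc: "continuous_on {0..} k" using k(1) by (intro DERIV_continuous_on) auto
  show "continuous_on {0..} (\<lambda>x. hderiv u x + s * (inverse (sqrt (k x)) / 2 * k' x))"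
    using kpos by (intro continuous_intros uc kc k(2)) (auto simp: less_imp_neq[symmetric])
  define N where "N = Cb_norm 1 u"
  have N: "\<bar>u x\<bar> \<le> N" "\<bar>hderiv u x\<bar> \<le> N" if "0 \<le> x" for x
    using Cb_bound[OF u, of 0 x] Cb_bound[OF u, of 1 x] that by (auto simp: N_def)
  have K0: "0 \<le> K" using K(2)[of 0] by simp
  show "\<bar>u x + s * sqrt (k x)\<bar> \<le> N + \<bar>s\<bar> * (sqrt K + K / sqrt C)" if x: "0 \<le> x" for x
  proof -
    have "sqrt (k x) \<le> sqrt K" using K(1)[OF x] by simp
    moreover have "0 \<le> K / sqrt C" using K0 C by simp
    moreover have "\<bar>sqrt (k x)\<bar> = sqrt (k x)" using kpos[OF x] by simp
    ultimately have "\<bar>sqrt (k x)\<bar> \<le> sqrt K + K / sqrt C" by linarith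
    then have "\<bar>s\<bar> * \<bar>sqrt (k x)\<bar> \<le> \<bar>s\<bar> * (sqrt K + K / sqrt C)" by (intro mult_left_mono) auto
    then show ?thesis using N(1)[OF x] unfolding abs_mult[symmetric] by linarith
  qed
  show "\<bar>hderiv u x + s * (inverse (sqrt (k x)) / 2 * k' x)\<bar> \<le> N + \<bar>s\<bar> * (sqrt K + K / sqrt C)" if x: "0 \<le> x" for x
  proof -
    have "inverse (sqrt (k x)) \<le> inverse (sqrt C)" using C(1) C(2)[OF x] by (intro le_imp_inverse_le) auto
    moreover have "0 < inverse (sqrt (k x))" using kpos[OF x] by simp
    ultimately have "\<bar>inverse (sqrt (k x)) / 2\<bar> \<le> inverse (sqrt C)" by linarith
    then have "\<bar>inverse (sqrt (k x)) / 2 * k' x\<bar> \<le> inverse (sqrt C) * K"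
      unfolding abs_mult using K(2)[OF x] kpos[OF x] C by (intro mult_mono) auto
    also have "\<dots> \<le> sqrt K + K / sqrt C" using K0 by (simp add: divide_inverse mult.commute)
    finally have "\<bar>s\<bar> * \<bar>inverse (sqrt (k x)) / 2 * k' x\<bar> \<le> \<bar>s\<bar> * (sqrt K + K / sqrt C)"
      by (intro mult_left_mono) auto
    then show ?thesis using N(2)[OF x] unfolding abs_mult[symmetric] by linarith
  qed
qed

lemma initial_valueI:
  assumes "continuous_on ({0..T} \<times> {0..}) (\<lambda>(t, x). v t x)" "0 < T" "\<And>x. 0 \<le> x \<Longrightarrow> v 0 x = v0 x"
  shows "initial_value T v v0"
  unfolding initial_value_def
proof (intro allI impI)
  fix x :: real assume x: "0 \<le> x"
  have "((\<lambda>(t, x). v t x) \<longlongrightarrow> (\<lambda>(t, x). v t x) (0, x)) (at (0, x) within {0..T} \<times> {0..})"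
    using assms(1,2) x unfolding continuous_on_def by auto
  then have "((\<lambda>(t, x). v t x) \<longlongrightarrow> v0 x) (at (0, x) within {0..T} \<times> {0..})"
    using assms(3)[OF x] by simp
  then show "((\<lambda>(t, x). v t x) \<longlongrightarrow> v0 x) (at (0, x) within Omega T)"
    by (rule tendsto_within_subset) (auto simp: Omega_def)
qed

section \<open>Positivity of the depth and return to the physical variables\<close>

context riemann
begin

definition solt where
  "solt t x = f x - speed (sol f T a b t) (sol f T b a t) x * solx f T a b t x"

lemma sol_deriv_t_at:
  assumes "0 < t" "t < T" "0 \<le> x"
  shows "((\<lambda>s. sol f T a b s x) has_real_derivative solt t x) (at t)"
  using sol_deriv_t[of t x] assms by (simp add: at_within_Icc_at solt_def)

lemma sol_speed:
  assumes "0 \<le> t" "t \<le> T" "0 \<le> x"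
  shows "speed (sol f T a b t) (sol f T b a t) x \<le> 0" "- M \<le> speed (sol f T a b t) (sol f T b a t) x"
  using sol_bounds[OF assms] riemann.sol_bounds[OF swap assms] unfolding speed_def
  by (simp_all add: abs_le_iff field_simps)

lemma solt_bound:
  assumes "0 \<le> t" "t \<le> T" "0 \<le> x"
  shows "\<bar>solt t x\<bar> \<le> B + M\<^sup>2"
proof -
  have "\<bar>speed (sol f T a b t) (sol f T b a t) x * solx f T a b t x\<bar> \<le> M * M"
    unfolding abs_mult using sol_speed[OF assms] solx_bound[OF assms] by (intro mult_mono) auto
  then show ?thesis unfolding solt_def power2_eq_square using f_bound[OF assms(3)] by linarith
qed

lemma Omega_subset: "Omega T \<subseteq> {0..T} \<times> {0..}"
  by (auto simp: Omega_def)

lemma solt_continuous: "continuous_on (Omega T) (\<lambda>(t, x). solt t x)"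
proof -
  have "continuous_on {0..} f" using f_deriv by (intro DERIV_continuous_on) auto
  then have "continuous_on (Omega T) (\<lambda>p. f (snd p))"
    by (rule continuous_on_compose2) (auto simp: Omega_def intro!: continuous_intros)
  then show ?thesis
    using continuous_on_subset[OF sol_continuous Omega_subset] continuous_on_subset[OF solx_continuous Omega_subset]
      continuous_on_subset[OF riemann.sol_continuous[OF swap] Omega_subset]
    unfolding solt_def speed_def case_prod_unfold by (intro continuous_intros) auto
qed

text \<open>In the difference of the two transport equations the sources cancel, and the two speeds
  differ by half the gap. The gap is therefore transported with the speed of the second invariant
  and a damping coefficient \<open>?Rx / 2\<close>, bounded by \<open>M\<close>; comparison with the
  barrier \<open>m * exp (- M * t)\<close> keeps it positive.\<close>

lemma sol_gap:
  assumes m: "0 < m" "\<And>x. 0 \<le> x \<Longrightarrow> m \<le> a x - b x" and tx: "0 < t" "t < T" "0 \<le> x"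
  shows "m * exp (- M * t) \<le> sol f T a b t x - sol f T b a t x"
proof -
  let ?R = "sol f T a b" and ?S = "sol f T b a" and ?Rx = "solx f T a b" and ?Sx = "solx f T b a"
  interpret sw: riemann f f' B A M T b a by (rule swap)
  define w where "w i t x = m * exp (- M * t) - (?R t x - ?S t x)" for i :: unit and t x
  have "w () t x \<le> 0"
  proof (rule max_principle[of "{()}" T w "\<lambda>_ t x. - M * m * exp (- M * t) - (solt t x - sw.solt t x)"
        "\<lambda>_ t x. - (?Rx t x - ?Sx t x)" "2 * (M\<^sup>2 + B)" "\<lambda>_ t. speed (?S t) (?R t)" M M])
    fix i t x assume tx: "0 < t" "t < (T::real)" "0 \<le> (x::real)"
    then have t: "0 \<le> t" "t \<le> T" by auto
    show "((\<lambda>s. w i s x) has_real_derivative - M * m * exp (- M * t) - (solt t x - sw.solt t x)) (at t)"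
      unfolding w_def using sol_deriv_t_at[OF tx] sw.sol_deriv_t_at[OF tx]
      by (auto intro!: derivative_eq_intros)
    show "(w i t has_real_derivative - (?Rx t x - ?Sx t x)) (at x within {0..})"
      unfolding w_def using sol_deriv_x[OF t tx(3)] sw.sol_deriv_x[OF t tx(3)]
      by (auto intro!: derivative_eq_intros)
    show "speed (?S t) (?R t) x \<le> 0" "- M \<le> speed (?S t) (?R t) x" using sw.sol_speed[OF t tx(3)] .
    have "0 \<le> M * t" using M_nonneg t by simp
    then have e: "m * exp (- M * t) \<le> m" using m by simp
    have "\<bar>?R t x - a x\<bar> \<le> (M\<^sup>2 + B) * t" "\<bar>?S t x - b x\<bar> \<le> (M\<^sup>2 + B) * t"
      using sol_time_lipschitz[of 0 t x] sw.sol_time_lipschitz[of 0 t x] t tx T_pos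
      by (simp_all add: sol_initial sw.sol_initial)
    then have "w i t x \<le> (M\<^sup>2 + B) * t + (M\<^sup>2 + B) * t"
      using m(2)[OF tx(3)] e unfolding w_def abs_le_iff by linarith
    then show "w i t x \<le> 2 * (M\<^sup>2 + B) * t" by (simp add: algebra_simps)
    assume pos: "0 < w i t x"
    define E where "E = m * exp (- M * t)"
    have E: "0 \<le> E" using m by (simp add: E_def)
    have "(- M * m * exp (- M * t) - (solt t x - sw.solt t x)) + speed (?S t) (?R t) x * - (?Rx t x - ?Sx t x)
        = - M * E + (?R t x - ?S t x) / 2 * ?Rx t x"
      by (simp add: E_def solt_def sw.solt_def speed_def field_simps)
    also have "\<dots> = E * (?Rx t x / 2 - M) - w i t x * (?Rx t x / 2)"
      by (simp add: w_def E_def field_simps)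
    also have "\<dots> \<le> 0 + w i t x * M"
    proof -
      have b: "?Rx t x / 2 - M \<le> 0" "- (?Rx t x / 2) \<le> M" using solx_bound[OF t tx(3)] M_nonneg by (auto simp: abs_le_iff)
      have "E * (?Rx t x / 2 - M) \<le> 0" using b E by (simp add: mult_nonneg_nonpos)
      moreover have "w i t x * (- (?Rx t x / 2)) \<le> w i t x * M" using b pos by (intro mult_left_mono) auto
      ultimately show ?thesis by simp
    qed
    finally show "(- M * m * exp (- M * t) - (solt t x - sw.solt t x)) + speed (?S t) (?R t) x * - (?Rx t x - ?Sx t x)
        \<le> M * w i t x" by (simp add: mult.commute)
  next
    show "continuous_on (Omega T) (\<lambda>(t, x). w i t x)" for i
      using continuous_on_subset[OF sol_continuous Omega_subset] continuous_on_subset[OF sw.sol_continuous Omega_subset]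
      unfolding w_def case_prod_unfold by (intro continuous_intros)
  qed (use tx in auto)
  then show ?thesis by (simp add: w_def)
qed

definition "velocity t x = (sol f T a b t x + sol f T b a t x) / 2"
definition "celerity t x = (sol f T a b t x - sol f T b a t x) / 4"

text \<open>Half the sum of the transport equations is \<open>u_t + u u_x + 2 c c_x = h'\<close>,
  the momentum equation for \<open>\<eta> = c\<^sup>2 - h\<close>. A quarter of their difference,
  multiplied by \<open>2 c\<close>, is the continuity equation for the depth
  \<open>c\<^sup>2\<close>. Recovering the depth as a square keeps all expressions polynomial in the
  invariants.\<close>

lemma shallow_water_exists:
  assumes h: "\<And>x. 0 \<le> x \<Longrightarrow> (h has_real_derivative f x) (at x within {0..})"
    and hB: "\<And>x. 0 \<le> x \<Longrightarrow> \<bar>h x\<bar> \<le> B"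
  shows "shallow_water_solution h (\<lambda>x. (a x + b x) / 2) (\<lambda>x. ((a x - b x) / 4)\<^sup>2 - h x) T
      velocity (\<lambda>t x. (celerity t x)\<^sup>2 - h x)" (is "shallow_water_solution h _ _ T _ ?\<eta>")
    and "celerity \<in> C11 T"
proof -
  let ?R = "sol f T a b" and ?S = "sol f T b a" and ?Rx = "solx f T a b" and ?Sx = "solx f T b a"
  interpret sw: riemann f f' B A M T b a by (rule swap)
  let ?ut = "\<lambda>t x. (solt t x + sw.solt t x) / 2" and ?ux = "\<lambda>t x. (?Rx t x + ?Sx t x) / 2"
  let ?ct = "\<lambda>t x. (solt t x - sw.solt t x) / 4" and ?cx = "\<lambda>t x. (?Rx t x - ?Sx t x) / 4"
  let ?et = "\<lambda>t x. 2 * celerity t x * ?ct t x" and ?ex = "\<lambda>t x. 2 * celerity t x * ?cx t x - f x"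
  define N where "N = M + B + M\<^sup>2"
  have N: "0 \<le> N" "M \<le> N" "B \<le> N" "B + M\<^sup>2 \<le> N" using M_nonneg B_nonneg by (auto simp: N_def)
  have t_deriv: "((\<lambda>s. velocity s x) has_real_derivative ?ut t x) (at t)"
      "((\<lambda>s. celerity s x) has_real_derivative ?ct t x) (at t)" if "0 < t" "t < T" "0 \<le> x" for t x
    unfolding velocity_def celerity_def using sol_deriv_t_at[OF that] sw.sol_deriv_t_at[OF that]
    by (auto intro!: derivative_eq_intros)
  have x_deriv: "(velocity t has_real_derivative ?ux t x) (at x within {0..})"
      "(celerity t has_real_derivative ?cx t x) (at x within {0..})" if "0 < t" "t < T" "0 \<le> x" for t x
    unfolding velocity_def celerity_def using sol_deriv_x[of t x] sw.sol_deriv_x[of t x] that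
    by (auto intro!: derivative_eq_intros)
  have bd: "\<bar>velocity t x\<bar> \<le> N" "\<bar>celerity t x\<bar> \<le> N" "\<bar>?ut t x\<bar> \<le> N" "\<bar>?ux t x\<bar> \<le> N" "\<bar>?ct t x\<bar> \<le> N" "\<bar>?cx t x\<bar> \<le> N"
    if "0 < t" "t < T" "0 \<le> x" for t x
  proof -
    have t: "0 \<le> t" "t \<le> T" using that by auto
    have b: "\<bar>?R t x\<bar> \<le> N" "\<bar>?S t x\<bar> \<le> N" "\<bar>?Rx t x\<bar> \<le> N" "\<bar>?Sx t x\<bar> \<le> N" "\<bar>solt t x\<bar> \<le> N" "\<bar>sw.solt t x\<bar> \<le> N"
      using sol_bounds(2)[OF t that(3)] sw.sol_bounds(2)[OF t that(3)] solx_bound[OF t that(3)] sw.solx_bound[OF t that(3)]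
        solt_bound[OF t that(3)] sw.solt_bound[OF t that(3)] N by linarith+
    have *: "\<bar>(p + q) / 2\<bar> \<le> N" "\<bar>(p - q) / 4\<bar> \<le> N" if "\<bar>p\<bar> \<le> N" "\<bar>q\<bar> \<le> N" for p q
      using that N(1) by (simp_all add: abs_le_iff field_simps)
    show "\<bar>velocity t x\<bar> \<le> N" "\<bar>celerity t x\<bar> \<le> N" "\<bar>?ut t x\<bar> \<le> N" "\<bar>?ux t x\<bar> \<le> N" "\<bar>?ct t x\<bar> \<le> N" "\<bar>?cx t x\<bar> \<le> N"
      unfolding velocity_def celerity_def using b by (blast intro: *)+
  qed
  note cont = continuous_on_subset[OF sol_continuous Omega_subset] continuous_on_subset[OF sw.sol_continuous Omega_subset]
    continuous_on_subset[OF solx_continuous Omega_subset] continuous_on_subset[OF sw.solx_continuous Omega_subset]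
    solt_continuous sw.solt_continuous
  have fc: "continuous_on {0..} f" using f_deriv by (intro DERIV_continuous_on) auto
  have f_cont: "continuous_on (Omega T) (\<lambda>p. f (snd p))"
    by (rule continuous_on_compose2[OF fc]) (auto simp: Omega_def intro!: continuous_intros)
  have hc: "continuous_on {0..} h" using h by (intro DERIV_continuous_on) auto
  have h_cont: "continuous_on ({0..T} \<times> {0..}) (\<lambda>p. h (snd p))"
    by (rule continuous_on_compose2[OF hc]) (auto intro!: continuous_intros)
  have ucont: "continuous_on (Omega T) (\<lambda>(t, x). ?ut t x)" "continuous_on (Omega T) (\<lambda>(t, x). ?ux t x)"
    and ccont: "continuous_on (Omega T) (\<lambda>(t, x). ?ct t x)" "continuous_on (Omega T) (\<lambda>(t, x). ?cx t x)"
    and econt: "continuous_on (Omega T) (\<lambda>(t, x). ?et t x)" "continuous_on (Omega T) (\<lambda>(t, x). ?ex t x)"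
    using cont f_cont unfolding celerity_def case_prod_unfold by (intro continuous_intros; simp)+
  show celC11: "celerity \<in> C11 T"
    by (rule C11I(1)[OF t_deriv(2) x_deriv(2) ccont bd(2,5,6)])
  have u: "velocity \<in> C11 T" "\<lbrakk>0 < t; t < T; 0 \<le> x\<rbrakk> \<Longrightarrow> dt velocity t x = ?ut t x"
    "\<lbrakk>0 < t; t < T; 0 \<le> x\<rbrakk> \<Longrightarrow> dx velocity t x = ?ux t x" for t x
    by (rule C11I[OF t_deriv(1) x_deriv(1) ucont bd(1,3,4)]; assumption)+
  have e_t: "((\<lambda>s. ?\<eta> s x) has_real_derivative ?et t x) (at t)" if "0 < t" "t < T" "0 \<le> x" for t x
    using t_deriv(2)[OF that] by (auto intro!: derivative_eq_intros)
  have e_x: "(?\<eta> t has_real_derivative ?ex t x) (at x within {0..})" if "0 < t" "t < T" "0 \<le> x" for t x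
    using x_deriv(2)[OF that] h[OF that(3)] by (auto intro!: derivative_eq_intros)
  have e_bd: "\<bar>?\<eta> t x\<bar> \<le> 2 * N * N + N" "\<bar>?et t x\<bar> \<le> 2 * N * N + N" "\<bar>?ex t x\<bar> \<le> 2 * N * N + N"
    if "0 < t" "t < T" "0 \<le> x" for t x
  proof -
    have p: "\<bar>celerity t x * z\<bar> \<le> N * N" if "\<bar>z\<bar> \<le> N" for z
      unfolding abs_mult using bd(2)[OF \<open>0 < t\<close> \<open>t < T\<close> \<open>0 \<le> x\<close>] that N by (intro mult_mono) auto
    have NN: "0 \<le> N * N" using N by simp
    show "\<bar>?\<eta> t x\<bar> \<le> 2 * N * N + N"
      using p[OF bd(2)[OF that]] hB[OF that(3)] N NN unfolding power2_eq_square by linarith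
    show "\<bar>?et t x\<bar> \<le> 2 * N * N + N" using p[OF bd(5)[OF that]] N unfolding mult.assoc by linarith
    show "\<bar>?ex t x\<bar> \<le> 2 * N * N + N"
      using p[OF bd(6)[OF that]] f_bound[OF that(3)] N unfolding mult.assoc by linarith
  qed
  have e: "?\<eta> \<in> C11 T" "\<lbrakk>0 < t; t < T; 0 \<le> x\<rbrakk> \<Longrightarrow> dt ?\<eta> t x = ?et t x"
    "\<lbrakk>0 < t; t < T; 0 \<le> x\<rbrakk> \<Longrightarrow> dx ?\<eta> t x = ?ex t x" for t x
    by (rule C11I[OF e_t e_x econt e_bd]; assumption)+
  have flux: "dx (\<lambda>s y. velocity s y * (h y + ?\<eta> s y)) t x = ?ux t x * (celerity t x)\<^sup>2 + velocity t x * (2 * celerity t x * ?cx t x)"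
    if "0 < t" "t < T" "0 \<le> x" for t x
    unfolding dx_def
  proof (rule hderiv_eqI)
    have "((\<lambda>y. velocity t y * (celerity t y)\<^sup>2) has_real_derivative
        ?ux t x * (celerity t x)\<^sup>2 + velocity t x * (2 * celerity t x * ?cx t x)) (at x within {0..})"
      using x_deriv[OF that] by (auto intro!: derivative_eq_intros)
    then show "((\<lambda>y. velocity t y * (h y + ?\<eta> t y)) has_real_derivative
        ?ux t x * (celerity t x)\<^sup>2 + velocity t x * (2 * celerity t x * ?cx t x)) (at x within {0..})"
      by simp
  qed (use that in simp)
  show "shallow_water_solution h (\<lambda>x. (a x + b x) / 2) (\<lambda>x. ((a x - b x) / 4)\<^sup>2 - h x) T velocity ?\<eta>"
    unfolding shallow_water_solution_def
  proof (intro conjI ballI)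
    show "velocity \<in> C11 T" by (rule u(1))
    show "?\<eta> \<in> C11 T" by (rule e(1))
    fix p assume "p \<in> Omega T"
    then obtain t x where p: "p = (t, x)" and tx: "0 < t" "t < T" "0 \<le> x" by (auto simp: Omega_def)
    show "case p of (t, x) \<Rightarrow> dt ?\<eta> t x + dx (\<lambda>s y. velocity s y * (h y + ?\<eta> s y)) t x = 0 \<and>
        dt velocity t x + velocity t x * dx velocity t x + dx ?\<eta> t x = 0"
      unfolding p prod.case flux[OF tx] u(2,3)[OF tx] e(2,3)[OF tx]
      by (simp add: velocity_def celerity_def solt_def sw.solt_def speed_def field_simps power2_eq_square)
  next
    show "initial_value T velocity (\<lambda>x. (a x + b x) / 2)"
      using sol_continuous sw.sol_continuous T_pos
      by (intro initial_valueI) (auto simp: velocity_def sol_initial sw.sol_initial case_prod_unfold intro!: continuous_intros)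
    show "initial_value T ?\<eta> (\<lambda>x. ((a x - b x) / 4)\<^sup>2 - h x)"
      using sol_continuous sw.sol_continuous T_pos h_cont
      by (intro initial_valueI) (auto simp: celerity_def sol_initial sw.sol_initial case_prod_unfold intro!: continuous_intros)
  qed
qed

end

theorem theorem1:
  fixes u0 \<eta>0 h \<phi>p \<phi>m :: "real \<Rightarrow> real" and C C\<phi> Ch T :: real
  assumes "u0 \<in> Cb 1" and "\<eta>0 \<in> Cb 1" and "h \<in> Cb 2"
    and "\<And>x. 0 \<le> x \<Longrightarrow> h x \<ge> 0"
    and "\<And>x. 0 \<le> x \<Longrightarrow> hderiv h x \<le> 0"
    and "C > 0"
    and "\<And>x. 0 \<le> x \<Longrightarrow> \<eta>0 x \<ge> C"
    and "\<And>x. 0 \<le> x \<Longrightarrow> u0 x \<le> - 2 * sqrt (h x + \<eta>0 x)"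
    and "\<phi>p = (\<lambda>x. u0 x + 2 * sqrt (h x + \<eta>0 x))"
    and "\<phi>m = (\<lambda>x. u0 x - 2 * sqrt (h x + \<eta>0 x))"
    and "C\<phi> = max (Cb_norm 1 \<phi>p) (Cb_norm 1 \<phi>m)"
    and "Ch = Cb_norm 2 h"
    and "T > 0"
    and "ereal T \<le> min (if Ch = 0 then \<infinity> else ereal (C\<phi> / Ch)) (ereal (1 / (15 * C\<phi>)))"
  shows "\<exists>u \<eta>. shallow_water_solution h u0 \<eta>0 T u \<eta> \<and>
           (\<forall>u' \<eta>'. shallow_water_solution h u0 \<eta>0 T u' \<eta>' \<longrightarrow>
              (\<forall>(t, x)\<in>Omega T. u' t x = u t x \<and> \<eta>' t x = \<eta> t x))"
proof -
  note u0 = assms(1) and \<eta>0 = assms(2) and hCb = assms(3) and T = assms(13)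
  have hd: "(h has_real_derivative hderiv h x) (at x within {0..})"
    "(hderiv h has_real_derivative hderiv (hderiv h) x) (at x within {0..})" if "0 \<le> x" for x
    using hCb that by (auto simp: Cb_def numeral_2_eq_2 less_Suc_eq intro!: hderiv_works)
  have hc: "continuous_on {0..} (hderiv h)" "continuous_on {0..} (hderiv (hderiv h))"
    using hCb by (auto simp: Cb_def numeral_2_eq_2 le_Suc_eq)
  have hb: "\<bar>h x\<bar> \<le> Ch" "\<bar>hderiv h x\<bar> \<le> Ch" "\<bar>hderiv (hderiv h) x\<bar> \<le> Ch" if "0 \<le> x" for x
    using Cb_bound[OF hCb, of 0 x] Cb_bound[OF hCb, of 1 x] Cb_bound[OF hCb, of 2 x] that assms(12)
    by (auto simp: numeral_2_eq_2)
  have ed: "(\<eta>0 has_real_derivative hderiv \<eta>0 x) (at x within {0..})" if "0 \<le> x" for x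
    using \<eta>0 that unfolding Cb_1_iff by (auto intro!: hderiv_works)
  have ec: "continuous_on {0..} (hderiv \<eta>0)" using \<eta>0 unfolding Cb_1_iff by simp
  have eb: "\<bar>\<eta>0 x\<bar> \<le> Cb_norm 1 \<eta>0" "\<bar>hderiv \<eta>0 x\<bar> \<le> Cb_norm 1 \<eta>0" if "0 \<le> x" for x
    using Cb_bound[OF \<eta>0, of 0 x] Cb_bound[OF \<eta>0, of 1 x] that by auto
  define H where "H x = h x + \<eta>0 x" for x
  have HC: "C \<le> H x" if "0 \<le> x" for x using assms(4)[OF that] assms(7)[OF that] by (simp add: H_def)
  have Hpos: "0 < H x" if "0 \<le> x" for x using HC[OF that] assms(6) by linarith
  have inv: "(\<lambda>x. u0 x + s * sqrt (H x)) \<in> Cb 1" for s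
  proof (rule riemann_invariant_Cb_1[OF u0])
    show "(H has_real_derivative hderiv h x + hderiv \<eta>0 x) (at x within {0..})" if "0 \<le> x" for x
      unfolding H_def using hd(1)[OF that] ed[OF that] by (rule DERIV_add)
    show "continuous_on {0..} (\<lambda>x. hderiv h x + hderiv \<eta>0 x)" by (intro continuous_intros hc ec)
    show "H x \<le> Ch + Cb_norm 1 \<eta>0" "\<bar>hderiv h x + hderiv \<eta>0 x\<bar> \<le> Ch + Cb_norm 1 \<eta>0" if "0 \<le> x" for x
      using hb[OF that] eb[OF that] unfolding H_def by linarith+
  qed (use HC assms(6) in auto)
  have \<phi>p: "\<phi>p = (\<lambda>x. u0 x + 2 * sqrt (H x))" and \<phi>m: "\<phi>m = (\<lambda>x. u0 x + (- 2) * sqrt (H x))"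
    using assms(9,10) by (simp_all add: H_def)
  have \<phi>Cb: "\<phi>p \<in> Cb 1" "\<phi>m \<in> Cb 1" unfolding \<phi>p \<phi>m by (rule inv)+
  have tame_of: "tame C\<phi> \<phi>" if "\<phi> \<in> Cb 1" "Cb_norm 1 \<phi> \<le> C\<phi>" "\<And>x. 0 \<le> x \<Longrightarrow> \<phi> x \<le> 0" for \<phi>
    unfolding tame_def
  proof (intro allI impI conjI)
    fix x :: real assume x: "0 \<le> x"
    show "\<phi> x \<le> 0" using that(3) x .
    show "\<bar>\<phi> x\<bar> \<le> C\<phi>" "\<bar>hderiv \<phi> x\<bar> \<le> C\<phi>"
      using Cb_bound[OF that(1), of 0 x] Cb_bound[OF that(1), of 1 x] that(2) x by auto
    show "\<phi> differentiable (at x within {0..})" using that(1) x unfolding Cb_1_iff by simp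
  qed
  have neg: "\<phi>p x \<le> 0" "\<phi>m x \<le> 0" if "0 \<le> x" for x
  proof -
    have "0 \<le> sqrt (H x)" "u0 x \<le> - 2 * sqrt (H x)" using assms(8)[OF that] Hpos[OF that] by (simp_all add: H_def)
    then show "\<phi>p x \<le> 0" "\<phi>m x \<le> 0" unfolding \<phi>p \<phi>m by linarith+
  qed
  have tm: "tame C\<phi> \<phi>p" "tame C\<phi> \<phi>m"
    using assms(11) by (intro tame_of \<phi>Cb neg max.cobounded1 max.cobounded2; simp)+
  have C\<phi>0: "0 \<le> C\<phi>" using tameD(2)[OF tm(1), of 0] by simp
  have T15: "T \<le> 1 / (15 * C\<phi>)" using assms(14) by simp
  \<comment> \<open>For \<open>C\<phi> = 0\<close> the bound would read
    \<open>T \<le> 1 / 0 = 0\<close> by the convention on division, against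
    \<open>T > 0\<close>.\<close>
  then have C\<phi>: "0 < C\<phi>" using C\<phi>0 T by (cases "C\<phi> = 0") auto
  have Tphi: "T * C\<phi> \<le> 1 / 15" using T15 C\<phi> by (simp add: field_simps)
  have Ch0: "0 \<le> Ch" using hb(1)[of 0] by simp
  have Th: "T * Ch \<le> C\<phi>"
  proof (cases "Ch = 0")
    case False
    then have "T \<le> C\<phi> / Ch" using assms(14) by simp
    then show ?thesis using False Ch0 by (simp add: field_simps)
  qed (use C\<phi> in simp)
  \<comment> \<open>With \<open>M = q * C\<phi>\<close>, the closing inequality follows from
    \<open>T * Ch \<le> C\<phi>\<close> and \<open>T * C\<phi> \<le> 1 / 15\<close> once
    \<open>2 + q\<^sup>2 / 15 \<le> q\<close>. The smallest such \<open>q\<close> is about 2.38, and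
    5/2 is a round value above it.\<close>
  define M where "M = 5 / 2 * C\<phi>"
  have MM: "C\<phi> + T * (M\<^sup>2 + Ch) \<le> M"
  proof -
    have "T * M\<^sup>2 = 25 / 4 * C\<phi> * (T * C\<phi>)" by (simp add: M_def power2_eq_square)
    also have "\<dots> \<le> 25 / 4 * C\<phi> * (1 / 15)" using Tphi C\<phi> by (intro mult_left_mono) auto
    finally show ?thesis using Th C\<phi> unfolding M_def by (simp add: algebra_simps)
  qed
  interpret riemann "hderiv h" "hderiv (hderiv h)" Ch C\<phi> M T \<phi>p \<phi>m
    by unfold_locales (use hd hc hb assms(5) tm \<phi>Cb[unfolded Cb_1_iff] T MM in auto)
  let ?\<eta> = "\<lambda>t x. (celerity t x)\<^sup>2 - h x"
  note ex = shallow_water_exists[OF hd(1) hb(1)]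
  have i1: "(\<phi>p x + \<phi>m x) / 2 = u0 x" "((\<phi>p x - \<phi>m x) / 4)\<^sup>2 - h x = \<eta>0 x" if "0 \<le> x" for x
    using Hpos[OF that] by (simp_all add: \<phi>p \<phi>m real_sqrt_pow2 less_imp_le) (simp add: H_def)
  \<comment> \<open>The reconstructed data are identified with \<open>u0\<close> and
    \<open>\<eta>0\<close> on the half-line, the only place where \<open>initial_value\<close> tests
    them.\<close>
  have sol: "shallow_water_solution h u0 \<eta>0 T velocity ?\<eta>"
    using ex(1) i1 by (simp add: shallow_water_solution_def initial_value_def)
  \<comment> \<open>The initial invariants differ by four times the square root of the depth, which
    is at least \<open>C\<close>.\<close>
  define m where "m = 4 * sqrt C"
  have m: "0 < m" "m \<le> \<phi>p x - \<phi>m x" if "0 \<le> x" for x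
    using assms(6) HC[OF that] by (simp_all add: m_def \<phi>p \<phi>m)
  have gap: "m * exp (- M * T) / 4 \<le> celerity t x" if "0 < t" "t < T" "0 \<le> x" for t x
  proof -
    have "m * exp (- M * T) \<le> m * exp (- M * t)" using m(1)[of 0] that M_nonneg by (simp add: mult_left_mono)
    then show ?thesis using sol_gap[OF m(1)[of 0] m(2) that] by (simp add: celerity_def)
  qed
  have uniq: "u' t x = velocity t x \<and> \<eta>' t x = ?\<eta> t x"
    if "shallow_water_solution h u0 \<eta>0 T u' \<eta>'" "0 < t" "t < T" "0 \<le> x" for u' \<eta>' t x
  proof (rule shallow_water_unique[OF sol that(1) hd(1) hb(2) ex(2)])
    show "0 < m * exp (- M * T) / 4" using m(1)[of 0] by simp
    show "velocity t x + celerity t x \<le> 0" if "0 < t" "t < T" "0 \<le> x" for t x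
    proof -
      \<comment> \<open>The faster characteristic speed \<open>u + c\<close> equals
        \<open>(3r + s)/4\<close>, whose sign is already known.\<close>
      have "velocity t x + celerity t x = speed (sol (hderiv h) T \<phi>p \<phi>m t) (sol (hderiv h) T \<phi>m \<phi>p t) x"
        by (simp add: velocity_def celerity_def speed_def field_simps)
      then show ?thesis using sol_speed(1)[of t x] that by simp
    qed
  qed (use gap that in auto)
  show ?thesis
    by (intro exI[of _ velocity] exI[of _ ?\<eta>]) (use sol uniq in \<open>auto simp: Omega_def\<close>)
qed

end
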